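(* Let $A$ be as in the context, with fraction field $K$, let $L$ be a finite extension of $K$, and let $\phi$ be a Drinfeld $A$-module over $L$. Then, up to isomorphism over $L$, at most finitely many twists $\psi$ of $\phi$ over $L$ have $({}^{\psi}L)_{\mathrm{tors}}\neq 0$.
   Context: $A$ denotes the ring of regular functions on the affine curve obtained by deleting a closed point $\infty$ from a nonsingular projective (irreducible) curve $X$ over a finite field $\mathbb{F}_q$; $K$ is the fraction field of $A$. For a field $L \supseteq K$ (always equipped with the inclusion homomorphism $A\to L$), a Drinfeld $A$-module of rank $r\ge 1$ over $L$ is an $\mathbb{F}_q$-algebra homomorphism $a\mapsto \phi_a$ from $A$ to the ring (under addition and composition) of $\mathbb{F}_q$-linear polynomials over $L$, such that for each nonzero $a\in A$, $\phi_a(x) = ax + (\text{higher powers of } x)$ has degree $(\# A/aA)^r$ in $x$. A Drinfeld $A$-module is one of some rank $r\ge 1$. Two Drinfeld modules $\phi,\psi$ over $L$ are isomorphic over a field $M\supseteq L$ if there is $u\in M^{*}$ with $\phi_a(ux) = u\,\psi_a(x)$ for all $a\in A$. A twist of $\phi$ over $L$ is a Drinfeld $A$-module over $L$ which becomes isomorphic to $\phi$ over the algebraic closure $\overline{L}$. The module ${}^{\psi}L$ is the additive group of $L$ with the $A$-module structure $a\cdot\alpha = \psi_a(\alpha)$, and $({}^{\psi}L)_{\mathrm{tors}} = \{\alpha\in L : \psi_a(\alpha)=0 \text{ for some nonzero } a\in A\}$. *)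

theory Defs
  imports "HOL-Algebra.Algebraic_Closure_Type" "HOL-Algebra.QuotRing" "HOL-Algebra.Generated_Fields"
begin

text \<open>
  All fields below the ambient field \<open>L\<close> are subsets of a type \<open>'l\<close> of class \<open>field\<close>, and \<open>L\<close> is
  the whole type. The structural notions (subring, subfield, finite extension, ...) are those of
  HOL-Algebra, applied to \<open>'l\<close> regarded as a ring record.
\<close>

abbreviation fld :: "'l::field ring" where
  "fld \<equiv> ring_of_type_algebra"


section \<open>Curves over a finite field and their affine coordinate rings\<close>

text \<open>
  A nonsingular projective irreducible curve \<open>X\<close> over \<open>k\<close> is given by its function field \<open>F\<close>, a
  finite extension of some \<open>k(t)\<close> with \<open>t\<close> transcendental over \<open>k\<close>. As \<open>X\<close> is not required to be
  geometrically irreducible, \<open>k\<close> need not be algebraically closed in \<open>F\<close>.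
\<close>

definition function_field :: "'l::field set \<Rightarrow> 'l set \<Rightarrow> bool" where
  "function_field k F \<longleftrightarrow>
     subfield k fld \<and> subfield F fld \<and> k \<subseteq> F \<and>
     (\<exists>t\<in>F. ring.transcendental fld k t \<and>
            ring.finite_dimension fld (generate_field fld (insert t k)) F)"

text \<open>
  A closed point of \<open>X\<close> is represented by its local ring. These local rings are exactly the
  valuation rings of \<open>F\<close> over \<open>k\<close>, all of which are discrete.
\<close>

definition closed_points :: "'l::field set \<Rightarrow> 'l set \<Rightarrow> 'l set set" where
  "closed_points k F =
     {V. subring V fld \<and> k \<subset> V \<and> V \<subset> F \<and> (\<forall>x\<in>F. x \<in> V \<or> inverse x \<in> V)}"

text \<open>
  Regular functions on \<open>X - {P}\<close>: the rational functions that lie in the local ring of every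
  closed point other than \<open>P\<close>.
\<close>

definition regular_functions :: "'l::field set \<Rightarrow> 'l set \<Rightarrow> 'l set \<Rightarrow> 'l set" where
  "regular_functions k F P = {x \<in> F. \<forall>V \<in> closed_points k F - {P}. x \<in> V}"

definition fraction_field :: "'l::field set \<Rightarrow> 'l set" where
  "fraction_field A = {a / b | a b. a \<in> A \<and> b \<in> A \<and> b \<noteq> 0}"


section \<open>Drinfeld modules\<close>

text \<open>\<open>q\<close>-linearised polynomials, i.e. those of the form \<open>\<Sum>j. c\<^sub>j x^(q^j)\<close>.\<close>

definition Fq_linear :: "nat \<Rightarrow> 'l::field poly \<Rightarrow> bool" where
  "Fq_linear q f \<longleftrightarrow> (\<forall>i. Polynomial.coeff f i \<noteq> 0 \<longrightarrow> (\<exists>j. i = q ^ j))"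

text \<open>
  The cardinality of \<open>A/aA\<close>. It is \<open>0\<close> if \<open>A/aA\<close> is infinite; in \<open>drinfeld_module_of_rank\<close> this
  cannot occur, since there \<open>\<phi> a\<close> has the nonzero coefficient \<open>a\<close> at \<open>x\<close> and hence positive degree.
\<close>

definition quotient_card :: "'l::field set \<Rightarrow> 'l \<Rightarrow> nat" where
  "quotient_card A a =
     (let R = fld\<lparr>carrier := A\<rparr> in card (carrier (R Quot (PIdl\<^bsub>R\<^esub> a))))"

text \<open>
  Only the restriction of \<open>\<phi>\<close> to \<open>A\<close> is meaningful. The multiplication of the target ring is
  composition, its identity is the polynomial \<open>x\<close>, and its \<open>k\<close>-algebra structure sends \<open>c\<close> to
  \<open>c x\<close>.
\<close>

definition drinfeld_module_of_rank ::
    "'l::field set \<Rightarrow> 'l set \<Rightarrow> nat \<Rightarrow> ('l \<Rightarrow> 'l poly) \<Rightarrow> bool" where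
  "drinfeld_module_of_rank k A r \<phi> \<longleftrightarrow>
     (\<forall>a\<in>A. Fq_linear (card k) (\<phi> a)) \<and>
     (\<forall>a\<in>A. \<forall>b\<in>A. \<phi> (a + b) = \<phi> a + \<phi> b) \<and>
     (\<forall>a\<in>A. \<forall>b\<in>A. \<phi> (a * b) = pcompose (\<phi> a) (\<phi> b)) \<and>
     (\<forall>c\<in>k. \<phi> c = [:0, c:]) \<and>
     (\<forall>a\<in>A. a \<noteq> 0 \<longrightarrow>
        Polynomial.coeff (\<phi> a) 1 = a \<and> Polynomial.degree (\<phi> a) = quotient_card A a ^ r)"

definition drinfeld_module :: "'l::field set \<Rightarrow> 'l set \<Rightarrow> ('l \<Rightarrow> 'l poly) \<Rightarrow> bool" where
  "drinfeld_module k A \<phi> \<longleftrightarrow> (\<exists>r\<ge>1. drinfeld_module_of_rank k A r \<phi>)"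

text \<open>
  Isomorphism over an extension \<open>M\<close> of \<open>L\<close>, where \<open>M\<close> is the type \<open>'m\<close> and \<open>\<iota>\<close> the embedding of
  \<open>L\<close> into \<open>M\<close>: the polynomial identity \<open>\<phi>\<^sub>a(u x) = u \<psi>\<^sub>a(x)\<close> over \<open>M\<close>.
\<close>

definition isomorphic_over ::
    "('l::field \<Rightarrow> 'm::field) \<Rightarrow> 'l set \<Rightarrow> ('l \<Rightarrow> 'l poly) \<Rightarrow> ('l \<Rightarrow> 'l poly) \<Rightarrow> bool" where
  "isomorphic_over \<iota> A \<phi> \<psi> \<longleftrightarrow>
     (\<exists>u. u \<noteq> 0 \<and>
        (\<forall>a\<in>A. pcompose (map_poly \<iota> (\<phi> a)) [:0, u:] = Polynomial.smult u (map_poly \<iota> (\<psi> a))))"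

definition isomorphism_rel :: "'l::field set \<Rightarrow> (('l \<Rightarrow> 'l poly) \<times> ('l \<Rightarrow> 'l poly)) set" where
  "isomorphism_rel A = {(\<phi>, \<psi>). isomorphic_over (id :: 'l \<Rightarrow> 'l) A \<phi> \<psi>}"

lemma equiv_isomorphism_rel: "equiv UNIV (isomorphism_rel A)"
proof (rule equivI)
  show "refl (isomorphism_rel A)"
    by (rule reflI)
      (auto simp: isomorphism_rel_def isomorphic_over_def map_poly_idI pcompose_idR intro!: exI[of _ 1])
  show "sym (isomorphism_rel A)"
  proof (rule symI)
    fix \<phi> \<psi> :: "'a \<Rightarrow> 'a poly"
    assume "(\<phi>, \<psi>) \<in> isomorphism_rel A"
    then obtain u where u: "u \<noteq> 0"
      and *: "\<And>a. a \<in> A \<Longrightarrow> pcompose (\<phi> a) [:0, u:] = Polynomial.smult u (\<psi> a)"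
      by (auto simp: isomorphism_rel_def isomorphic_over_def map_poly_idI)
    have "pcompose (\<psi> a) [:0, inverse u:] = Polynomial.smult (inverse u) (\<phi> a)" if "a \<in> A" for a
    proof -
      have "\<psi> a = Polynomial.smult (inverse u) (pcompose (\<phi> a) [:0, u:])"
        using u *[OF that] by simp
      then have "pcompose (\<psi> a) [:0, inverse u:]
          = Polynomial.smult (inverse u) (pcompose (\<phi> a) (pcompose [:0, u:] [:0, inverse u:]))"
        by (metis pcompose_assoc pcompose_smult)
      also have "pcompose [:0, u:] [:0, inverse u:] = [:0, 1:]"
        using u by (simp add: pcompose_pCons)
      finally show ?thesis by (simp add: pcompose_idR)
    qed
    then show "(\<psi>, \<phi>) \<in> isomorphism_rel A"
      using u by (auto simp: isomorphism_rel_def isomorphic_over_def map_poly_idI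
          intro!: exI[of _ "inverse u"])
  qed
  show "trans (isomorphism_rel A)"
  proof (rule transI)
    fix \<phi> \<psi> \<chi> :: "'a \<Rightarrow> 'a poly"
    assume "(\<phi>, \<psi>) \<in> isomorphism_rel A" "(\<psi>, \<chi>) \<in> isomorphism_rel A"
    then obtain u v where uv: "u \<noteq> 0" "v \<noteq> 0"
      and 1: "\<And>a. a \<in> A \<Longrightarrow> pcompose (\<phi> a) [:0, u:] = Polynomial.smult u (\<psi> a)"
      and 2: "\<And>a. a \<in> A \<Longrightarrow> pcompose (\<psi> a) [:0, v:] = Polynomial.smult v (\<chi> a)"
      by (auto simp: isomorphism_rel_def isomorphic_over_def map_poly_idI)
    have "pcompose (\<phi> a) [:0, u * v:] = Polynomial.smult (u * v) (\<chi> a)" if "a \<in> A" for a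
    proof -
      have "pcompose (\<phi> a) [:0, u * v:] = pcompose (pcompose (\<phi> a) [:0, u:]) [:0, v:]"
        by (simp add: pcompose_assoc[symmetric] pcompose_pCons mult.commute)
      then show ?thesis using 1[OF that] 2[OF that] by (simp add: pcompose_smult)
    qed
    then show "(\<phi>, \<chi>) \<in> isomorphism_rel A"
      using uv by (auto simp: isomorphism_rel_def isomorphic_over_def map_poly_idI
          intro!: exI[of _ "u * v"])
  qed
qed auto

definition is_twist ::
    "'l::field set \<Rightarrow> 'l set \<Rightarrow> ('l \<Rightarrow> 'l poly) \<Rightarrow> ('l \<Rightarrow> 'l poly) \<Rightarrow> bool" where
  "is_twist k A \<phi> \<psi> \<longleftrightarrow>
     drinfeld_module k A \<psi> \<and> isomorphic_over (to_ac :: 'l \<Rightarrow> 'l alg_closure) A \<phi> \<psi>"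

definition torsion :: "'l::field set \<Rightarrow> ('l \<Rightarrow> 'l poly) \<Rightarrow> 'l set" where
  "torsion A \<psi> = {\<alpha>. \<exists>a\<in>A. a \<noteq> 0 \<and> poly (\<psi> a) \<alpha> = 0}"

end

theory Submission
  imports Defs
begin

text \<open>
  A twist \<open>\<psi>\<close> of \<open>\<phi>\<close> is given by an element \<open>u\<close> of the algebraic closure with \<open>\<phi>\<^sub>a(u x) = u \<psi>\<^sub>a(x)\<close>. If
  \<open>\<alpha> \<noteq> 0\<close> is a torsion point of \<open>\<psi>\<close> in \<open>L\<close>, then \<open>w = u \<alpha>\<close> is a torsion point of \<open>\<phi>\<close>, and \<open>w\<close> determines
  \<open>\<psi>\<close> up to isomorphism over \<open>L\<close>. Suppose that \<open>\<phi>\<^sub>T\<close> has degree \<open>d \<ge> 2\<close> for some \<open>T\<close> in \<open>A\<close>. Comparing the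
  leading coefficients of \<open>\<phi>\<^sub>T\<close> and \<open>\<psi>\<^sub>T\<close> shows that the power \<open>d - 1\<close> of \<open>w\<close> lies in \<open>L\<close>. Thus \<open>w\<close> has bounded
  degree over \<open>L\<close>, and the theorem is an instance of the principle that a Drinfeld module has only
  finitely many torsion points of bounded degree. If there is no such \<open>T\<close>, then every twist of \<open>\<phi>\<close>
  is \<open>a \<mapsto> a x\<close> and has no nonzero torsion, so there is nothing to prove.

  The finiteness is Northcott's, with poles instead of heights. A torsion point has a finite orbit under
  \<open>\<phi>\<^sub>T\<close>. At every valuation a point that is larger than certain elements of \<open>L\<close> formed from
  the coefficients of \<open>\<phi>\<^sub>T\<close> escapes to infinity under iteration (\<open>finite_orbit_bounded\<close>). So the
  element \<open>w\<^sup>d\<^sup>-\<^sup>1\<close> of \<open>L\<close> has its poles bounded independently of \<open>\<psi>\<close>, that is, it lies in a fixed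
  Riemann--Roch space, and such a space over a finite field is finite (\<open>finite_bounded_poles\<close>).

  The latter is proved directly. Let \<open>L\<close> be finite over \<open>k(t)\<close>, and let \<open>O\<close> be the ring of elements of
  \<open>L\<close> whose poles are poles of \<open>t\<close>. Elements of \<open>O\<close> that are independent over \<open>k\<close> modulo \<open>t O\<close> are
  independent over \<open>k(t)\<close>, so that \<open>O / t O\<close>, and with it every \<open>O / t\<^sup>s O\<close>, is finite. For large \<open>s\<close> the
  Riemann--Roch space injects into \<open>O / t\<^sup>s O\<close>, because a function that has no poles and vanishes at the
  poles of \<open>t\<close> is \<open>0\<close>. This last fact rests on Chevalley's theorem that there are enough valuation rings
  (\<open>exists_valuation_subring\<close>). Throughout, places are valuation rings of the algebraic closure, and
  integrality means membership in them.
\<close>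

section \<open>Polynomials with coefficients in a subring\<close>

lemma fld_simps:
  "carrier fld = UNIV" "\<zero>\<^bsub>fld\<^esub> = (0 :: 'a::field)" "\<one>\<^bsub>fld\<^esub> = (1 :: 'a)"
  "x \<oplus>\<^bsub>fld\<^esub> y = (x + y :: 'a)" "x \<otimes>\<^bsub>fld\<^esub> y = (x * y :: 'a)"
  by (simp_all add: ring_of_type_algebra_def)

lemma subring_fld_iff:
  "subring S (fld :: 'a::field ring) \<longleftrightarrow>
     1 \<in> S \<and> (\<forall>x\<in>S. \<forall>y\<in>S. x - y \<in> S \<and> x * y \<in> S)" (is "_ \<longleftrightarrow> ?R")
proof -
  interpret field "fld :: 'a ring" by (rule field_from_type_algebra)
  have minus: "\<ominus>\<^bsub>fld\<^esub> x = - x" for x :: 'a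
    by (rule minus_equality) (auto simp: ring_of_type_algebra_def)
  show ?thesis
  proof
    assume S: "subring S (fld :: 'a ring)"
    show ?R
    proof (intro conjI ballI)
      show "1 \<in> S" using subringE(3)[OF S] by (simp add: ring_of_type_algebra_def)
      fix x y assume xy: "x \<in> S" "y \<in> S"
      show "x * y \<in> S" using subringE(6)[OF S xy] by (simp add: ring_of_type_algebra_def)
      have "- y \<in> S" using subringE(5)[OF S xy(2)] by (simp add: minus)
      then show "x - y \<in> S" using subringE(7)[OF S xy(1), of "- y"]
        by (simp add: ring_of_type_algebra_def)
    qed
  next
    assume R: ?R
    have z: "0 \<in> S" using R by (metis diff_self)
    have m: "- x \<in> S" if "x \<in> S" for x using R z that by (metis diff_0)
    have a: "x + y \<in> S" if "x \<in> S" "y \<in> S" for x y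
      using R m[OF that(2)] that by (metis diff_minus_eq_add)
    show "subring S (fld :: 'a ring)"
      by (rule subringI) (use R m a in \<open>auto simp: minus\<close>, auto simp: ring_of_type_algebra_def)
  qed
qed

lemma subfield_fld_iff:
  "subfield S (fld :: 'a::field ring) \<longleftrightarrow> subring S fld \<and> (\<forall>x\<in>S. inverse x \<in> S)"
proof -
  interpret field "fld :: 'a ring" by (rule field_from_type_algebra)
  have inv: "inv\<^bsub>fld\<^esub> x = inverse x" if "x \<noteq> 0" for x :: 'a
    by (rule comm_inv_char) (use that in \<open>auto simp: ring_of_type_algebra_def\<close>)
  show ?thesis
  proof
    assume S: "subfield S (fld :: 'a ring)"
    have "inverse x \<in> S" if "x \<in> S" for x
    proof (cases "x = 0")
      case False
      then show ?thesis
        using subfield_m_inv(1)[OF S, of x] that inv[OF False]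
        by (simp add: ring_of_type_algebra_def)
    qed (use that in simp)
    then show "subring S fld \<and> (\<forall>x\<in>S. inverse x \<in> S)" using subfieldE(1)[OF S] by blast
  next
    assume R: "subring S (fld :: 'a ring) \<and> (\<forall>x\<in>S. inverse x \<in> S)"
    show "subfield S (fld :: 'a ring)"
    proof (rule subfieldI')
      fix x :: 'a assume "x \<in> S - {\<zero>\<^bsub>fld\<^esub>}"
      then show "inv\<^bsub>fld\<^esub> x \<in> S" using R inv[of x] by (simp add: ring_of_type_algebra_def)
    qed (use R in simp)
  qed
qed

context
  fixes S :: "'a::field set"
  assumes S: "subring S fld"
begin

lemma subring_one: "1 \<in> S" and subring_diff: "x \<in> S \<Longrightarrow> y \<in> S \<Longrightarrow> x - y \<in> S"
  and subring_mult: "x \<in> S \<Longrightarrow> y \<in> S \<Longrightarrow> x * y \<in> S"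
  using S by (auto simp: subring_fld_iff)

lemma subring_zero: "0 \<in> S"
  using subring_diff[OF subring_one subring_one] by simp

lemma subring_uminus: "x \<in> S \<Longrightarrow> - x \<in> S"
  using subring_diff[OF subring_zero, of x] by simp

lemma subring_add: "x \<in> S \<Longrightarrow> y \<in> S \<Longrightarrow> x + y \<in> S"
  using subring_diff[of x "- y"] subring_uminus[of y] by simp

lemma subring_power: "x \<in> S \<Longrightarrow> x ^ n \<in> S"
  by (induction n) (auto intro: subring_one subring_mult)

lemma subring_sum: "(\<And>i. i \<in> I \<Longrightarrow> f i \<in> S) \<Longrightarrow> sum f I \<in> S"
  by (induction I rule: infinite_finite_induct) (auto intro: subring_zero subring_add)

lemma subring_prod: "(\<And>i. i \<in> I \<Longrightarrow> f i \<in> S) \<Longrightarrow> prod f I \<in> S"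
  by (induction I rule: infinite_finite_induct) (auto intro: subring_one subring_mult)

lemmas subring_closed = subring_one subring_zero subring_diff subring_mult subring_uminus
  subring_add subring_power subring_sum subring_prod

end

definition coeffs_in :: "'a::zero set \<Rightarrow> 'a poly \<Rightarrow> bool" where
  "coeffs_in S p \<longleftrightarrow> (\<forall>i. Polynomial.coeff p i \<in> S)"

lemma coeffs_in_pCons_iff: "coeffs_in S (pCons a p) \<longleftrightarrow> a \<in> S \<and> coeffs_in S p"
  by (auto simp: coeffs_in_def coeff_pCons split: nat.splits)

lemma coeffs_in_0_iff: "coeffs_in S 0 \<longleftrightarrow> 0 \<in> S"
  by (simp add: coeffs_in_def)

lemma coeffs_in_mono: "coeffs_in S p \<Longrightarrow> S \<subseteq> S' \<Longrightarrow> coeffs_in S' p"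
  by (auto simp: coeffs_in_def)

lemma coeffs_in_subring:
  assumes S: "subring S (fld :: 'a::field ring)"
  shows coeffs_in_diff: "coeffs_in S p \<Longrightarrow> coeffs_in S q \<Longrightarrow> coeffs_in S (p - q)"
    and coeffs_in_add: "coeffs_in S p \<Longrightarrow> coeffs_in S q \<Longrightarrow> coeffs_in S (p + q)"
    and coeffs_in_mult: "coeffs_in S p \<Longrightarrow> coeffs_in S q \<Longrightarrow> coeffs_in S (p * q)"
    and coeffs_in_monom: "a \<in> S \<Longrightarrow> coeffs_in S (Polynomial.monom a n)"
    and coeffs_in_reflect: "coeffs_in S p \<Longrightarrow> coeffs_in S (reflect_poly p)"
    and coeffs_in_one: "coeffs_in S 1"
    and coeffs_in_const: "a \<in> S \<Longrightarrow> coeffs_in S [:a:]"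
    and poly_in_subring: "coeffs_in S p \<Longrightarrow> x \<in> S \<Longrightarrow> poly p x \<in> S"
proof -
  note c = subring_closed[OF S]
  show "coeffs_in S p \<Longrightarrow> coeffs_in S q \<Longrightarrow> coeffs_in S (p - q)"
    "coeffs_in S p \<Longrightarrow> coeffs_in S q \<Longrightarrow> coeffs_in S (p + q)"
    "a \<in> S \<Longrightarrow> coeffs_in S (Polynomial.monom a n)"
    "coeffs_in S p \<Longrightarrow> coeffs_in S (reflect_poly p)"
    "coeffs_in S 1"
    "a \<in> S \<Longrightarrow> coeffs_in S [:a:]"
    using c(1-6) by (auto simp: coeffs_in_def coeff_reflect_poly coeff_pCons split: nat.splits)
  show "coeffs_in S p \<Longrightarrow> coeffs_in S q \<Longrightarrow> coeffs_in S (p * q)"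
    by (auto simp: coeffs_in_def coeff_mult intro!: c)
  show "coeffs_in S p \<Longrightarrow> x \<in> S \<Longrightarrow> poly p x \<in> S"
    by (auto simp: coeffs_in_def poly_altdef intro!: c)
qed

lemma coeffs_in_prod:
  assumes "subring S (fld :: 'a::field ring)" "\<And>i. i \<in> I \<Longrightarrow> coeffs_in S (p i)"
  shows "coeffs_in S (prod p I)"
  using assms(2)
  by (induction I rule: infinite_finite_induct)
    (auto intro: coeffs_in_one[OF assms(1)] coeffs_in_mult[OF assms(1)])

lemma coeffs_in_power:
  assumes "subring S (fld :: 'a::field ring)" "coeffs_in S p"
  shows "coeffs_in S (p ^ n)"
  using assms(2)
  by (induction n) (auto intro: coeffs_in_one[OF assms(1)] coeffs_in_mult[OF assms(1)])

section \<open>Valuation rings\<close>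

locale valuation_subring =
  fixes V :: "'m::field set"
  assumes subring: "subring V fld"
    and total: "x \<in> V \<or> inverse x \<in> V"
begin

lemmas closed = subring_closed[OF subring]

text \<open>
  The maximal ideal of \<open>V\<close>. In the language of the absolute value of \<open>V\<close>, \<open>z \<in> V\<close> means \<open>|z| \<le> 1\<close>
  and \<open>z \<in> nonunits\<close> means \<open>|z| < 1\<close>. A strict inequality
  \<open>|b| < |x|\<close> reads \<open>b / x \<in> nonunits\<close>.
\<close>

definition nonunits :: "'m set" where
  "nonunits = {z. z = 0 \<or> inverse z \<notin> V}"

lemma nonunits_subset: "z \<in> nonunits \<Longrightarrow> z \<in> V"
  using total[of z] closed(2) by (auto simp: nonunits_def)

lemma one_notin_nonunits: "1 \<notin> nonunits"
  by (simp add: nonunits_def closed(1))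

lemma nonunits_mult:
  assumes "z \<in> nonunits" "v \<in> V"
  shows "v * z \<in> nonunits"
proof (rule ccontr)
  assume "v * z \<notin> nonunits"
  then have nz: "v * z \<noteq> 0" and "inverse (v * z) \<in> V" by (auto simp: nonunits_def)
  then have "v * inverse (v * z) \<in> V" using assms closed by blast
  also have "v * inverse (v * z) = inverse z" using nz by (simp add: field_simps)
  finally show False using assms nz by (auto simp: nonunits_def)
qed

text \<open>
  One of \<open>y/z\<close> and \<open>z/y\<close> lies in \<open>V\<close>, so the sum is a multiple of one of the two summands.
\<close>

lemma nonunits_add:
  assumes "y \<in> nonunits" "z \<in> nonunits"
  shows "y + z \<in> nonunits"
proof -
  have *: "y + z \<in> nonunits" if "y \<in> nonunits" "z \<in> nonunits" "y \<noteq> 0" "z * inverse y \<in> V" for y z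
  proof -
    have "(1 + z * inverse y) * y \<in> nonunits"
      using that closed by (intro nonunits_mult) auto
    also have "(1 + z * inverse y) * y = y + z" using that(3) by (simp add: field_simps)
    finally show ?thesis .
  qed
  show ?thesis
  proof (cases "y = 0 \<or> z = 0")
    case True then show ?thesis using assms by auto
  next
    case False
    have "z * inverse y \<in> V \<or> y * inverse z \<in> V"
      using total[of "z * inverse y"] False by (simp add: mult.commute)
    then show ?thesis
      using *[OF assms] *[OF assms(2,1)] False by (auto simp: add.commute)
  qed
qed

lemma nonunits_zero: "0 \<in> nonunits"
  by (simp add: nonunits_def)

lemma nonunits_sum: "(\<And>i. i \<in> I \<Longrightarrow> f i \<in> nonunits) \<Longrightarrow> sum f I \<in> nonunits"
  by (induction I rule: infinite_finite_induct) (auto intro: nonunits_add nonunits_zero)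

text \<open>
  The ultrametric principle that an element of absolute value \<open>1\<close> absorbs a smaller one.
\<close>

lemma unit_plus_nonunit:
  assumes "v \<in> V" "inverse v \<in> V" "v \<noteq> 0" "z \<in> nonunits"
  shows "v + z \<noteq> 0" "inverse (v + z) \<in> V"
proof -
  have "v + z \<notin> nonunits"
  proof
    assume "v + z \<in> nonunits"
    moreover have "- 1 * z \<in> nonunits"
      using assms closed by (intro nonunits_mult) auto
    ultimately have "v + z + - 1 * z \<in> nonunits" by (rule nonunits_add)
    then show False using assms by (auto simp: nonunits_def)
  qed
  then show "v + z \<noteq> 0" "inverse (v + z) \<in> V" by (auto simp: nonunits_def)
qed

lemma nonunits_power: "z \<in> nonunits \<Longrightarrow> n \<noteq> 0 \<Longrightarrow> z ^ n \<in> nonunits"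
proof (induction n)
  case (Suc n)
  then show ?case using closed nonunits_subset nonunits_mult[of z "z ^ n"]
    by (simp add: mult.commute)
qed simp

text \<open>
  The nonzero elements of \<open>k\<close> are units of \<open>V\<close>, so if \<open>|y| < 1\<close> then the lowest nonzero term of
  \<open>g(y)\<close> dominates the others and \<open>g(y)\<close> cannot vanish unless \<open>y\<close> does.
\<close>

lemma root_in_nonunits_eq_0:
  assumes k: "subfield k fld" "k \<subseteq> V" and y: "y \<in> nonunits"
    and g: "coeffs_in k g" "g \<noteq> 0" "poly g y = 0"
  shows "y = 0"
proof (rule ccontr)
  assume "y \<noteq> 0"
  from g show False
  proof (induction g)
    case 0 then show ?case by simp
  next
    case (pCons a g)
    have g: "coeffs_in k g" "a \<in> k" using pCons.prems by (auto simp: coeffs_in_pCons_iff)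
    show False
    proof (cases "a = 0")
      case True
      with pCons g \<open>y \<noteq> 0\<close> show False by auto
    next
      case False
      have a: "a \<in> V" "inverse a \<in> V" using g k by (auto simp: subfield_fld_iff)
      have "poly g y \<in> V"
        using coeffs_in_mono[OF g(1) k(2)] y nonunits_subset by (intro poly_in_subring[OF subring])
      then have "poly g y * y \<in> nonunits" by (intro nonunits_mult y)
      with unit_plus_nonunit(1)[OF a False this] pCons.prems show False
        by (simp add: mult.commute)
    qed
  qed
qed

end

text \<open>
  The descent step of Chevalley's extension theorem. If the ideal \<open>I\<close> generates the unit ideal both
  in \<open>B[z]\<close> and in \<open>B[1/z]\<close>, the relation of larger degree can be shortened by means of the other.
\<close>

lemma reduce_degree_of_unit_representation:
  fixes B :: "'m::field set"
  assumes B: "subring B fld" and I: "I \<subseteq> B" "\<And>a b. a \<in> I \<Longrightarrow> b \<in> B \<Longrightarrow> b * a \<in> I"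
      "\<And>a b. a \<in> I \<Longrightarrow> b \<in> I \<Longrightarrow> a - b \<in> I" "1 \<notin> I"
    and unit: "\<And>a. a \<in> I \<Longrightarrow> inverse (1 - a) \<in> B"
    and p: "coeffs_in I p" "poly p z = 1"
    and q: "coeffs_in I q" "poly q (inverse z) = 1"
    and z: "z \<noteq> 0" and le: "Polynomial.degree q \<le> Polynomial.degree p"
  obtains p' where "coeffs_in I p'" "poly p' z = 1" "Polynomial.degree p' < Polynomial.degree p"
proof -
  define n where "n = Polynomial.degree q"
  define m where "m = Polynomial.degree p"
  define c where "c = Polynomial.coeff q"
  define u where "u = inverse (1 - c 0)"
  have cI: "c i \<in> I" for i using q by (auto simp: c_def coeffs_in_def)
  have u: "u \<in> B" "1 - c 0 \<noteq> 0" using unit cI[of 0] I(4) by (auto simp: u_def)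
  have I0: "0 \<in> I" using I(3)[OF cI cI, of 0 0] by simp
  have Im: "- a \<in> I" if "a \<in> I" for a using I(3)[OF I0 that] by simp
  have Ia: "a + b \<in> I" if "a \<in> I" "b \<in> I" for a b using I(3)[OF that(1) Im[OF that(2)]] by simp
  have Is: "sum f A \<in> I" if "\<And>i. i \<in> A \<Longrightarrow> f i \<in> I" for f :: "nat \<Rightarrow> 'm" and A
    using that by (induction A rule: infinite_finite_induct) (auto intro: I0 Ia)
  have npos: "n > 0"
  proof (rule ccontr)
    assume "\<not> n > 0"
    then obtain a where "q = [:a:]" using degree_eq_zeroE[of q] by (auto simp: n_def)
    with q cI[of 0] I(4) show False by (auto simp: c_def)
  qed
  \<comment> \<open>Solving the relation in \<open>1/z\<close> for its constant term writes \<open>1\<close>, hence the leading term of \<open>p\<close>,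
      through strictly lower powers of \<open>z\<close>.\<close>
  define r where "r = (\<Sum>i=1..n. Polynomial.monom (u * c i) (m - i))"
  have "poly q (inverse z) = c 0 + (\<Sum>i=1..n. c i * inverse z ^ i)"
    unfolding poly_altdef n_def[symmetric] c_def[symmetric]
    by (subst atMost_atLeast0, subst sum.atLeast_Suc_atMost) auto
  then have "(\<Sum>i=1..n. c i * inverse z ^ i) = 1 - c 0" using q by (simp add: algebra_simps)
  then have "u * (\<Sum>i=1..n. c i * inverse z ^ i) = 1" using u by (simp add: u_def)
  then have "z ^ m = z ^ m * (u * (\<Sum>i=1..n. c i * inverse z ^ i))" by simp
  also have "\<dots> = poly r z"
    unfolding r_def sum_distrib_left poly_sum
  proof (rule sum.cong[OF refl])
    fix i assume "i \<in> {1..n}"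
    then have "z ^ m = z ^ (m - i) * z ^ i" using le
      by (simp add: m_def n_def flip: power_add)
    then show "z ^ m * (u * (c i * inverse z ^ i)) = poly (Polynomial.monom (u * c i) (m - i)) z"
      using z by (simp add: poly_monom field_simps)
  qed
  finally have rz: "z ^ m = poly r z" .
  have rI: "coeffs_in I r"
    unfolding r_def coeffs_in_def by (auto simp: coeff_sum intro!: Is I(2) cI u I0)
  have rdeg: "Polynomial.degree r < m"
  proof -
    have mpos: "m > 0" using npos le by (simp add: m_def n_def)
    have "Polynomial.degree r \<le> m - 1"
      unfolding r_def by (intro degree_sum_le order.trans[OF degree_monom_le]) auto
    then show ?thesis using mpos by linarith
  qed
  define b where "b = lead_coeff p"
  define p' where "p' = p - Polynomial.monom b m + Polynomial.smult b r"
  have bI: "b \<in> I" using p by (simp add: b_def coeffs_in_def)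
  show ?thesis
  proof
    show "coeffs_in I p'"
      using p(1) rI bI I(1) I0
      by (auto simp: p'_def coeffs_in_def intro!: Ia I(3) I(2)[of _ b])
    show "poly p' z = 1" by (simp add: p'_def poly_monom rz p)
    have "Polynomial.degree (p - Polynomial.monom b m) \<le> m"
      by (intro degree_diff_le) (auto simp: m_def degree_monom_le)
    moreover have "Polynomial.coeff (p - Polynomial.monom b m) m = 0"
      by (simp add: b_def m_def)
    ultimately have "Polynomial.degree (p - Polynomial.monom b m) < m"
      using rdeg by (metis Polynomial.degree_0 bot_nat_0.not_eq_extremum le_neq_implies_less
          leading_coeff_0_iff less_nat_zero_code)
    moreover have "Polynomial.degree (Polynomial.smult b r) < m"
      using rdeg degree_smult_le[of b r] by linarith
    ultimately show "Polynomial.degree p' < Polynomial.degree p"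
      unfolding p'_def m_def by (rule degree_add_less)
  qed
qed

text \<open>
  Chevalley's extension theorem, in the form that an element outside \<open>S\<close> whose inverse lies in \<open>S\<close>
  has a pole at some valuation ring containing \<open>S\<close>. A maximal ring among those that contain \<open>S\<close> but
  not \<open>y\<close> does it: if it contained neither \<open>z\<close> nor \<open>1/z\<close>, adjoining either would bring in \<open>y\<close>, and
  an infinite descent on the degrees of the two resulting relations gives a contradiction.
\<close>

theorem exists_valuation_subring:
  fixes S :: "'m::field set"
  assumes S: "subring S fld" and y: "inverse y \<in> S" "y \<notin> S"
  obtains V where "valuation_subring V" "S \<subseteq> V" "y \<notin> V"
proof -
  define BB where "BB = {B. subring B (fld :: 'm ring) \<and> S \<subseteq> B \<and> y \<notin> B}"
  have "\<exists>V\<in>BB. \<forall>W\<in>BB. V \<subseteq> W \<longrightarrow> W = V"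
  proof (rule subset_Zorn_nonempty)
    show "BB \<noteq> {}" using assms by (auto simp: BB_def)
    fix C assume C: "C \<noteq> {}" "subset.chain BB C"
    have sub: "subring B fld" "S \<subseteq> B" "y \<notin> B" if "B \<in> C" for B
      using C that by (auto simp: subset.chain_def BB_def)
    have "subring (\<Union>C) (fld :: 'm ring)"
      unfolding subring_fld_iff
    proof (intro conjI ballI)
      show "1 \<in> \<Union>C" using C sub by (auto simp: subring_fld_iff)
      fix a b assume "a \<in> \<Union>C" "b \<in> \<Union>C"
      then obtain B1 B2 where B: "B1 \<in> C" "B2 \<in> C" "a \<in> B1" "b \<in> B2" by auto
      then obtain B where "B \<in> C" "a \<in> B" "b \<in> B"
        using C(2) unfolding subset_chain_def by blast
      then show "a - b \<in> \<Union>C" "a * b \<in> \<Union>C" using sub[of B] by (auto simp: subring_fld_iff)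
    qed
    then show "\<Union>C \<in> BB" using sub C(1) unfolding BB_def by blast
  qed
  then obtain B where B: "subring B fld" "S \<subseteq> B" "y \<notin> B"
    and max: "\<And>W. subring W fld \<Longrightarrow> B \<subseteq> W \<Longrightarrow> y \<notin> W \<Longrightarrow> W = B"
    unfolding BB_def by (auto simp: subset_iff)
  note c = subring_closed[OF B(1)]
  define x where "x = inverse y"
  have x: "x \<in> B" "x \<noteq> 0" "y = inverse x" using y B c(2) by (auto simp: x_def)
  define I where "I = (\<lambda>b. x * b) ` B"
  have I: "I \<subseteq> B" "\<And>a b. a \<in> I \<Longrightarrow> b \<in> B \<Longrightarrow> b * a \<in> I"
      "\<And>a b. a \<in> I \<Longrightarrow> b \<in> I \<Longrightarrow> a - b \<in> I"
    using x c by (auto simp: I_def mult.left_commute simp flip: right_diff_distrib)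
  have I1: "1 \<notin> I"
  proof
    assume "1 \<in> I"
    then obtain b where "b \<in> B" "x * b = 1" by (auto simp: I_def)
    then show False using x B(3) by (metis inverse_unique)
  qed
  \<comment> \<open>By maximality, any element adjoined to \<open>B\<close> brings in \<open>1/x\<close>, that is, makes \<open>1\<close> a multiple
      of \<open>x\<close>.\<close>
  have adjoin: "\<exists>p. coeffs_in I p \<and> poly p z = 1" if z: "z \<notin> B" for z
  proof -
    define W where "W = {poly p z | p. coeffs_in B p}"
    have "subring W fld"
      unfolding subring_fld_iff W_def
    proof (intro conjI ballI)
      show "1 \<in> {poly p z |p. coeffs_in B p}"
        using coeffs_in_one[OF B(1)] by (auto intro!: exI[of _ 1])
    next
      fix a b assume "a \<in> {poly p z |p. coeffs_in B p}" "b \<in> {poly p z |p. coeffs_in B p}"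
      then obtain p q where pq: "a = poly p z" "b = poly q z" "coeffs_in B p" "coeffs_in B q" by auto
      show "a - b \<in> {poly p z |p. coeffs_in B p}"
        using pq coeffs_in_diff[OF B(1) pq(3,4)] by (auto intro!: exI[of _ "p - q"])
      show "a * b \<in> {poly p z |p. coeffs_in B p}"
        using pq coeffs_in_mult[OF B(1) pq(3,4)] by (auto intro!: exI[of _ "p * q"])
    qed
    moreover have "B \<subseteq> W"
    proof
      fix b assume "b \<in> B"
      then have "coeffs_in B [:b:]" by (rule coeffs_in_const[OF B(1)])
      then show "b \<in> W" unfolding W_def by (intro CollectI exI[of _ "[:b:]"]) simp
    qed
    moreover have "z \<in> W"
    proof -
      have "coeffs_in B [:0, 1:]" using c by (simp add: coeffs_in_pCons_iff coeffs_in_0_iff)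
      then show ?thesis unfolding W_def by (intro CollectI exI[of _ "[:0, 1:]"]) simp
    qed
    ultimately have "y \<in> W" using max z by blast
    then obtain p where p: "coeffs_in B p" "y = poly p z" by (auto simp: W_def)
    have "coeffs_in I (Polynomial.smult x p)" using p by (auto simp: coeffs_in_def I_def)
    moreover have "poly (Polynomial.smult x p) z = 1" using p x by (metis poly_smult right_inverse)
    ultimately show ?thesis by blast
  qed
  have unit: "inverse (1 - a) \<in> B" if a: "a \<in> I" for a
  proof (rule ccontr)
    define v where "v = 1 - a"
    have v: "v \<in> B" "v \<noteq> 0" using a I(1) I1 c by (auto simp: v_def)
    assume "inverse (1 - a) \<notin> B"
    then obtain p where p: "coeffs_in I p" "poly p (inverse v) = 1"
      using adjoin[of "inverse v"] by (auto simp: v_def)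
    define n where "n = Polynomial.degree p"
    have "v ^ n = poly (reflect_poly p) v"
      using poly_reflect_poly_nz[OF v(2), of p] p by (simp add: n_def)
    also have "\<dots> \<in> I"
    proof -
      have "reflect_poly p = Polynomial.smult x (reflect_poly (Polynomial.smult (inverse x) p))"
        using x by (simp add: reflect_poly_smult)
      moreover have "coeffs_in B (Polynomial.smult (inverse x) p)"
        unfolding coeffs_in_def
      proof
        fix i
        have "Polynomial.coeff p i \<in> I" using p by (simp add: coeffs_in_def)
        then show "Polynomial.coeff (Polynomial.smult (inverse x) p) i \<in> B"
          using x by (auto simp: I_def simp flip: mult.assoc)
      qed
      then have "poly (reflect_poly (Polynomial.smult (inverse x) p)) v \<in> B"
        using v by (intro poly_in_subring[OF B(1)] coeffs_in_reflect[OF B(1)])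
      ultimately show ?thesis unfolding I_def by (metis imageI poly_smult)
    qed
    finally have vn: "v ^ n \<in> I" .
    \<comment> \<open>\<open>v\<close> is \<open>1\<close> modulo \<open>I\<close>, so no power of it can lie in the proper ideal \<open>I\<close>.\<close>
    have "1 - v ^ i \<in> I" for i
    proof (induction i)
      case 0 then show ?case using I(3)[OF a a] by simp
    next
      case (Suc i)
      have "1 - v ^ Suc i = (1 - v ^ i) - - (v ^ i) * a" by (simp add: v_def algebra_simps)
      then show ?case using I Suc a v c by metis
    qed
    from I(3)[OF this[of n], of "- 1 * v ^ n"] I(2)[OF vn, of "- 1"] c(1,5) I1 show False by simp
  qed
  have no_pair: "\<not> (coeffs_in I p \<and> poly p z = 1 \<and> coeffs_in I q \<and> poly q (inverse z) = 1)"
    if "z \<noteq> 0" for p q z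
    using that
  proof (induction "Polynomial.degree p + Polynomial.degree q" arbitrary: p q z rule: less_induct)
    case less
    show ?case
    proof
      assume *: "coeffs_in I p \<and> poly p z = 1 \<and> coeffs_in I q \<and> poly q (inverse z) = 1"
      show False
      proof (cases "Polynomial.degree q \<le> Polynomial.degree p")
        case True
        obtain p' where "coeffs_in I p'" "poly p' z = 1" "Polynomial.degree p' < Polynomial.degree p"
          by (rule reduce_degree_of_unit_representation[OF B(1) I I1 unit, of p z q])
            (use * less.prems True in auto)
        then show False using less.hyps[of p' q z] * less.prems by auto
      next
        case False
        obtain q' where "coeffs_in I q'" "poly q' (inverse z) = 1"
            "Polynomial.degree q' < Polynomial.degree q"
          by (rule reduce_degree_of_unit_representation[OF B(1) I I1 unit, of q "inverse z" p])
            (use * less.prems False in auto)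
        then show False using less.hyps[of p q' z] * less.prems by auto
      qed
    qed
  qed
  have "valuation_subring B"
  proof (rule valuation_subring.intro)
    fix z :: 'm
    show "z \<in> B \<or> inverse z \<in> B"
    proof (rule ccontr)
      assume "\<not> (z \<in> B \<or> inverse z \<in> B)"
      moreover from this have "z \<noteq> 0" using c(2) by auto
      ultimately show False using adjoin[of z] adjoin[of "inverse z"] no_pair[of z] by blast
    qed
  qed (rule B(1))
  then show ?thesis using that B by blast
qed

text \<open>
  A nonconstant function has a pole. If \<open>y\<close> has none, then by Chevalley's theorem \<open>y\<close> lies in \<open>k[1/y]\<close>,
  and clearing denominators gives a monic relation for \<open>y\<close> over \<open>k\<close>.
\<close>

theorem in_all_valuation_subrings_imp_algebraic:
  fixes y :: "'m::field"
  assumes k: "subfield k fld"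
    and y: "\<And>V. valuation_subring V \<Longrightarrow> k \<subseteq> V \<Longrightarrow> y \<in> V"
  obtains g where "coeffs_in k g" "g \<noteq> 0" "poly g y = 0"
proof (cases "y = 0")
  case True
  have "coeffs_in k [:0, 1:]" using k subring_zero subring_one
    by (auto simp: subfield_fld_iff coeffs_in_pCons_iff coeffs_in_0_iff)
  then show ?thesis using that[of "[:0, 1:]"] True by auto
next
  case False
  have kr: "subring k fld" using k by (simp add: subfield_fld_iff)
  define S where "S = {poly p (inverse y) | p. coeffs_in k p}"
  have S: "subring S fld"
    unfolding subring_fld_iff S_def
  proof (intro conjI ballI)
    show "1 \<in> {poly p (inverse y) |p. coeffs_in k p}"
      using coeffs_in_one[OF kr] by (auto intro!: exI[of _ 1])
  next
    fix a b assume "a \<in> {poly p (inverse y) |p. coeffs_in k p}" "b \<in> {poly p (inverse y) |p. coeffs_in k p}"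
    then obtain p q where pq: "a = poly p (inverse y)" "b = poly q (inverse y)" "coeffs_in k p" "coeffs_in k q"
      by auto
    show "a - b \<in> {poly p (inverse y) |p. coeffs_in k p}"
      using pq coeffs_in_diff[OF kr pq(3,4)] by (auto intro!: exI[of _ "p - q"])
    show "a * b \<in> {poly p (inverse y) |p. coeffs_in k p}"
      using pq coeffs_in_mult[OF kr pq(3,4)] by (auto intro!: exI[of _ "p * q"])
  qed
  have kS: "k \<subseteq> S"
    unfolding S_def using coeffs_in_const[OF kr] by (force intro!: exI[of _ "[:_:]"])
  have yS: "inverse y \<in> S"
  proof -
    have "coeffs_in k [:0, 1:]" using subring_closed[OF kr]
      by (simp add: coeffs_in_pCons_iff coeffs_in_0_iff)
    then show ?thesis unfolding S_def by (intro CollectI exI[of _ "[:0, 1:]"]) simp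
  qed
  have "y \<in> S"
  proof (rule ccontr)
    assume "y \<notin> S"
    with exists_valuation_subring[OF S yS] obtain V where "valuation_subring V" "S \<subseteq> V" "y \<notin> V"
      by blast
    then show False using y kS by blast
  qed
  then obtain p where p: "coeffs_in k p" "y = poly p (inverse y)" by (auto simp: S_def)
  define d where "d = Polynomial.degree p"
  define g where "g = Polynomial.monom 1 (Suc d) - reflect_poly p"
  show ?thesis
  proof
    show "coeffs_in k g" unfolding g_def
      using p by (intro coeffs_in_subring[OF kr] subring_one[OF kr])
    have "Polynomial.coeff (reflect_poly p) (Suc d) = 0"
      by (simp add: coeff_reflect_poly d_def)
    then have "Polynomial.coeff g (Suc d) = 1" by (simp add: g_def)
    then show "g \<noteq> 0" by auto
    show "poly g y = 0"
      using poly_reflect_poly_nz[OF False, of p] p(2)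
      by (simp add: g_def poly_monom d_def)
  qed
qed

section \<open>Size estimates in a valuation ring\<close>

text \<open>
  If \<open>|x|\<close> exceeds the absolute value of each of these finitely many elements, the leading term of
  \<open>f\<close> dominates \<open>f(x)\<close> and makes it larger than \<open>x\<close>. For a given \<open>f\<close> the same elements serve all
  absolute values.
\<close>

definition escape_bounds :: "'m::field poly \<Rightarrow> 'm set" where
  "escape_bounds f = insert 1 (insert (inverse (lead_coeff f))
     ((\<lambda>i. Polynomial.coeff f i / lead_coeff f) ` {..<Polynomial.degree f}))"

context valuation_subring
begin

text \<open>
  Writing \<open>c x\<^sup>d\<close> for the leading term, \<open>f(x) = c x\<^sup>d (1 + e)\<close> with \<open>|e| < 1\<close>, because \<open>c\<^sub>i/c\<close> is smaller than
  \<open>x\<close> and hence than \<open>x\<close> to the power \<open>d - i\<close>. As \<open>d \<ge> 2\<close> and \<open>|1/c| < |x|\<close>, also \<open>|x| < |c x\<^sup>d|\<close>.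
\<close>

lemma escape_step:
  assumes f: "Polynomial.degree f \<ge> 2"
    and x: "x \<noteq> 0" "\<And>b. b \<in> escape_bounds f \<Longrightarrow> b / x \<in> nonunits"
  shows "poly f x \<noteq> 0" "x / poly f x \<in> nonunits"
proof -
  define d where "d = Polynomial.degree f"
  define c where "c = lead_coeff f"
  have c: "c \<noteq> 0" using f by (auto simp: c_def)
  have ix: "inverse x \<in> nonunits" using x(2)[of 1] by (simp add: escape_bounds_def field_simps)
  then have ixV: "inverse x ^ j \<in> V" for j by (intro closed(7) nonunits_subset)
  define e where "e = (\<Sum>i<d. inverse x ^ (d - Suc i) * (Polynomial.coeff f i / c / x))"
  have "e \<in> nonunits" unfolding e_def
    by (intro nonunits_sum nonunits_mult ixV x(2)) (auto simp: escape_bounds_def d_def c_def)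
  then have e: "1 + e \<noteq> 0" "inverse (1 + e) \<in> V"
    using unit_plus_nonunit[of 1 e] closed by auto
  have "poly f x = (\<Sum>i\<le>d. Polynomial.coeff f i * x ^ i)" by (simp add: poly_altdef d_def)
  also have "\<dots> = (\<Sum>i<d. Polynomial.coeff f i * x ^ i) + c * x ^ d"
    by (simp add: c_def d_def flip: lessThan_Suc_atMost)
  also have "(\<Sum>i<d. Polynomial.coeff f i * x ^ i) = c * x ^ d * e"
    unfolding e_def sum_distrib_left
  proof (rule sum.cong[OF refl])
    fix i assume "i \<in> {..<d}"
    then have "d = (d - Suc i) + 1 + i" by simp
    then have "x ^ d = x ^ (d - Suc i) * x * x ^ i" by (metis power_add power_one_right)
    then show "Polynomial.coeff f i * x ^ i =
        c * x ^ d * (inverse x ^ (d - Suc i) * (Polynomial.coeff f i / c / x))"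
      using x(1) c by (simp add: field_simps)
  qed
  finally have fx: "poly f x = c * x ^ d * (1 + e)" by (simp add: algebra_simps)
  then show "poly f x \<noteq> 0" using c x e by simp
  have "d = (d - 2) + 1 + 1" using f by (simp add: d_def)
  then have "x ^ d = x ^ (d - 2) * x * x" by (metis power_add power_one_right)
  then have "x / (c * x ^ d * w) = (inverse x ^ (d - 2) * inverse w) * (inverse c / x)" for w
    using x(1) c by (simp add: divide_inverse power_inverse)
  from this[of "1 + e"] have "x / poly f x = (inverse x ^ (d - 2) * inverse (1 + e)) * (inverse c / x)"
    unfolding fx .
  also have "\<dots> \<in> nonunits"
    using ixV e(2) by (intro nonunits_mult closed(4) x(2)) (auto simp: escape_bounds_def c_def)
  finally show "x / poly f x \<in> nonunits" .
qed

text \<open>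
  Otherwise each iterate would again escape and be strictly larger than its predecessor, so that the
  orbit would be infinite.
\<close>

lemma finite_orbit_bounded:
  assumes f: "Polynomial.degree f \<ge> 2"
    and orbit: "finite (range (\<lambda>j. (poly f ^^ j) x))"
  shows "\<exists>b\<in>escape_bounds f. b \<noteq> 0 \<and> x / b \<in> V"
proof (rule ccontr)
  assume "\<not> ?thesis"
  then have *: "x / b \<notin> V" if "b \<in> escape_bounds f" "b \<noteq> 0" for b using that by blast
  define xs where "xs j = (poly f ^^ j) x" for j
  have grow: "xs j \<noteq> 0 \<and> (\<forall>b\<in>escape_bounds f. b / xs j \<in> nonunits)" for j
  proof (induction j)
    case 0
    have "x \<noteq> 0" using *[of 1] closed by (auto simp: escape_bounds_def)
    then show ?case using * by (auto simp: xs_def nonunits_def)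
  next
    case (Suc j)
    have s: "xs (Suc j) = poly f (xs j)" by (simp add: xs_def)
    from escape_step[OF f, of "xs j"] Suc
    have 1: "poly f (xs j) \<noteq> 0" "xs j / poly f (xs j) \<in> nonunits" by auto
    have "b / poly f (xs j) \<in> nonunits" if "b \<in> escape_bounds f" for b
    proof -
      have "(xs j / poly f (xs j)) * (b / xs j) \<in> nonunits"
        using Suc that 1(2) nonunits_subset by (intro nonunits_mult) auto
      then show ?thesis using Suc by (simp add: field_simps)
    qed
    with 1 s show ?case by simp
  qed
  have step: "xs j / xs (Suc j) \<in> nonunits" for j
    using escape_step(2)[OF f, of "xs j"] grow by (simp add: xs_def)
  have "xs i / xs (i + Suc l) \<in> nonunits" for i l
  proof (induction l)
    case (Suc l)
    have "xs i / xs (i + Suc l) * (xs (i + Suc l) / xs (Suc (i + Suc l))) \<in> nonunits"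
      using Suc nonunits_subset step by (intro nonunits_mult) auto
    then show ?case using grow by simp
  qed (use step in simp)
  note far = this
  have neq: "xs i \<noteq> xs (i + Suc l)" for i l
    using far[of i l] grow[of "i + Suc l"] one_notin_nonunits by (intro notI) simp
  have "inj xs"
  proof (rule linorder_injI)
    fix i j :: nat assume "i < j"
    then obtain l where "j = i + Suc l" using less_iff_Suc_add by auto
    then show "xs i \<noteq> xs j" using neq by simp
  qed
  then show False using orbit range_inj_infinite unfolding xs_def by blast
qed

text \<open>
  The leading coefficient is a denominator for a root. If \<open>a\<^sub>d b\<close> were not in \<open>V\<close>, then \<open>1/b\<close> would be,
  and dividing the relation by the power \<open>d - 1\<close> of \<open>b\<close> would express \<open>a\<^sub>d b\<close> through elements of \<open>V\<close>.
\<close>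

lemma leading_coeff_times_root:
  assumes a: "\<And>i. i \<le> d \<Longrightarrow> a i \<in> V" and d: "d > 0" and root: "(\<Sum>i\<le>d. a i * b ^ i) = 0"
  shows "a d * b \<in> V"
proof (rule ccontr)
  assume z: "a d * b \<notin> V"
  then have nz: "a d \<noteq> 0" "b \<noteq> 0" using closed by auto
  have "a d * inverse (a d * b) \<in> V" using z total a closed by blast
  then have b: "inverse b \<in> V" using nz by (simp add: field_simps)
  have "inverse b ^ (d - 1) * (\<Sum>i\<le>d. a i * b ^ i) = (\<Sum>i<d. inverse b ^ (d - 1 - i) * a i) + a d * b"
  proof -
    have "inverse b ^ (d - 1) * (\<Sum>i\<le>d. a i * b ^ i) =
        (\<Sum>i<d. inverse b ^ (d - 1) * (a i * b ^ i)) + inverse b ^ (d - 1) * (a d * b ^ d)"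
      by (simp add: distrib_left sum_distrib_left flip: lessThan_Suc_atMost)
    also have "inverse b ^ (d - 1) * (a d * b ^ d) = a d * b"
      using d nz by (cases d) (auto simp: field_simps)
    also have "(\<Sum>i<d. inverse b ^ (d - 1) * (a i * b ^ i)) = (\<Sum>i<d. inverse b ^ (d - 1 - i) * a i)"
    proof (rule sum.cong[OF refl])
      fix i assume "i \<in> {..<d}"
      then have "inverse b ^ (d - 1) = inverse b ^ (d - 1 - i) * inverse b ^ i"
        by (simp flip: power_add)
      then show "inverse b ^ (d - 1) * (a i * b ^ i) = inverse b ^ (d - 1 - i) * a i"
        using nz by (simp add: field_simps)
    qed
    finally show ?thesis .
  qed
  then have "a d * b = - (\<Sum>i<d. inverse b ^ (d - 1 - i) * a i)"
    using root by (simp add: eq_neg_iff_add_eq_0 add.commute)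
  also have "\<dots> \<in> V" using a b by (intro closed) auto
  finally show False using z by contradiction
qed

context
  fixes k t
  assumes k: "subfield k fld" "k \<subseteq> V" and t: "t \<notin> V"
begin

text \<open>
  At a pole of \<open>t\<close> a polynomial of degree \<open>m\<close> in \<open>t\<close> over \<open>k\<close> is as large as \<open>t\<^sup>m\<close>. The next lemmas
  state the two inequalities separately, and deduce a bound for algebraic functions of \<open>t\<close>.
\<close>

lemma inverse_t: "inverse t \<in> nonunits" "inverse t \<in> V" "t \<noteq> 0"
  using t total closed by (auto simp: nonunits_def)

lemma poly_at_pole:
  assumes p: "coeffs_in k p" "Polynomial.degree p \<le> e"
  shows "poly p t / t ^ e \<in> V"
proof -
  have "poly p t / t ^ e = (\<Sum>i\<le>Polynomial.degree p. Polynomial.coeff p i * inverse t ^ (e - i))"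
    unfolding poly_altdef sum_divide_distrib
  proof (rule sum.cong[OF refl])
    fix i assume "i \<in> {..Polynomial.degree p}"
    then have "t ^ e = t ^ (e - i) * t ^ i" using p by (simp flip: power_add)
    then show "Polynomial.coeff p i * t ^ i / t ^ e = Polynomial.coeff p i * inverse t ^ (e - i)"
      using inverse_t(3) by (simp add: field_simps)
  qed
  also have "\<dots> \<in> V" using p k inverse_t by (intro closed) (auto simp: coeffs_in_def)
  finally show ?thesis .
qed

lemma inverse_poly_at_pole:
  assumes p: "coeffs_in k p" "p \<noteq> 0"
  shows "poly p t \<noteq> 0" "t ^ Polynomial.degree p / poly p t \<in> V"
proof -
  define m where "m = Polynomial.degree p"
  define c where "c = lead_coeff p"
  have c: "c \<in> V" "inverse c \<in> V" "c \<noteq> 0"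
    using p k by (auto simp: c_def coeffs_in_def subfield_fld_iff)
  define z where "z = (\<Sum>i<m. Polynomial.coeff p i * inverse t ^ (m - i))"
  have "z \<in> nonunits" unfolding z_def
    using p k by (intro nonunits_sum nonunits_mult nonunits_power inverse_t) (auto simp: coeffs_in_def)
  note u = unit_plus_nonunit[OF c this]
  have "poly p t = (\<Sum>i<m. Polynomial.coeff p i * t ^ i) + c * t ^ m"
    by (simp add: poly_altdef c_def m_def flip: lessThan_Suc_atMost)
  also have "(\<Sum>i<m. Polynomial.coeff p i * t ^ i) = z * t ^ m"
    unfolding z_def sum_distrib_right
  proof (rule sum.cong[OF refl])
    fix i assume "i \<in> {..<m}"
    then have "t ^ m = t ^ (m - i) * t ^ i" by (simp flip: power_add)
    then show "Polynomial.coeff p i * t ^ i = Polynomial.coeff p i * inverse t ^ (m - i) * t ^ m"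
      using inverse_t(3) by (simp add: field_simps)
  qed
  finally have "poly p t = t ^ m * (c + z)" by (simp add: algebra_simps)
  then show "poly p t \<noteq> 0" "t ^ Polynomial.degree p / poly p t \<in> V"
    using u inverse_t(3) by (auto simp: m_def[symmetric] divide_inverse simp flip: mult.assoc)
qed

text \<open>
  After division by \<open>t\<^sup>e\<close> the relation has coefficients in \<open>V\<close>. Its leading coefficient is a denominator
  of \<open>b\<close>, and it is as large as \<open>t\<close> to the power \<open>deg p\<^sub>d - e\<close>.
\<close>

lemma root_at_pole:
  assumes p: "\<And>i. i \<le> d \<Longrightarrow> coeffs_in k (p i)" "\<And>i. i \<le> d \<Longrightarrow> Polynomial.degree (p i) \<le> e" "p d \<noteq> 0"
    and d: "d > 0" and root: "(\<Sum>i\<le>d. poly (p i) t * b ^ i) = 0"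
  shows "b / t ^ e \<in> V"
proof -
  define m where "m = Polynomial.degree (p d)"
  have "(\<Sum>i\<le>d. poly (p i) t / t ^ e * b ^ i) = (\<Sum>i\<le>d. poly (p i) t * b ^ i) / t ^ e"
    by (simp add: sum_divide_distrib)
  then have 1: "poly (p d) t / t ^ e * b \<in> V"
    using p root by (intro leading_coeff_times_root[OF _ d] poly_at_pole) auto
  note 2 = inverse_poly_at_pole[OF p(1)[OF order.refl] p(3)]
  have "poly (p d) t / t ^ e * b * (t ^ m / poly (p d) t) * inverse t ^ m \<in> V"
    unfolding m_def by (intro closed(4) closed(7) 1 2(2) inverse_t(2))
  also have "poly (p d) t / t ^ e * b * (t ^ m / poly (p d) t) * inverse t ^ m = b / t ^ e"
    using 2(1) inverse_t(3) by (simp add: field_simps)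
  finally show ?thesis .
qed

end

end

section \<open>Finiteness of Riemann--Roch spaces over a finite field\<close>

text \<open>
  The setting is a finite extension \<open>L\<close> of \<open>k(t)\<close> inside a larger field, with \<open>k\<close> finite and \<open>t\<close>
  transcendental. The bound \<open>[L : k(t)] \<le> n\<close> is stated with denominators cleared. Places are
  taken on the larger field, so that elements of \<open>L\<close> can be compared with elements of that field.
\<close>

locale finite_over_rational_functions =
  fixes k L :: "'m::field set" and t :: 'm and n :: nat
  assumes finite_k: "finite k" and k: "subfield k fld" and L: "subfield L fld"
    and k_subset: "k \<subseteq> L" and t_in: "t \<in> L"
    and transcendental: "coeffs_in k p \<Longrightarrow> poly p t = 0 \<Longrightarrow> p = 0"
    and dependent: "(\<And>i. i \<le> n \<Longrightarrow> y i \<in> L) \<Longrightarrow>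
      \<exists>p. (\<forall>i\<le>n. coeffs_in k (p i)) \<and> (\<exists>i\<le>n. p i \<noteq> 0) \<and> (\<Sum>i\<le>n. poly (p i) t * y i) = 0"
begin

lemma k_subring: "subring k fld" and L_subring: "subring L fld"
  using k L by (auto simp: subfield_fld_iff)

lemmas k_closed = subring_closed[OF k_subring]
lemmas L_closed = subring_closed[OF L_subring]

lemma t_nonzero: "t \<noteq> 0"
  using transcendental[of "[:0, 1:]"] k_closed(1,2)
  by (auto simp: coeffs_in_pCons_iff coeffs_in_0_iff)

definition place :: "'m set \<Rightarrow> bool" where
  "place V \<longleftrightarrow> valuation_subring V \<and> k \<subseteq> V"

lemma pole_of_t_exists: obtains V where "place V" "t \<notin> V"
proof (rule ccontr)
  assume "\<not> thesis"
  then have "\<And>V. valuation_subring V \<Longrightarrow> k \<subseteq> V \<Longrightarrow> t \<in> V" using that by (auto simp: place_def)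
  then obtain g where "coeffs_in k g" "g \<noteq> 0" "poly g t = 0"
    using in_all_valuation_subrings_imp_algebraic[OF k] by metis
  then show False using transcendental by blast
qed

text \<open>
  Such a \<open>y\<close> has no pole at all, so it is algebraic over \<open>k\<close>; and it vanishes at the poles of \<open>t\<close>, of
  which there is at least one, so it is \<open>0\<close>.
\<close>

lemma no_poles_imp_0:
  assumes "\<And>V. place V \<Longrightarrow> t \<in> V \<Longrightarrow> y \<in> V" "\<And>V. place V \<Longrightarrow> t \<notin> V \<Longrightarrow> t * y \<in> V"
  shows "y = 0"
proof -
  have pole: "y \<in> valuation_subring.nonunits V" if V: "place V" "t \<notin> V" for V
  proof -
    interpret valuation_subring V using V by (simp add: place_def)
    have "inverse y \<notin> V" if "y \<noteq> 0"
    proof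
      assume "inverse y \<in> V"
      then have "t * y * inverse y \<in> V" using assms(2)[OF V] closed by blast
      with V that show False by (simp add: mult.assoc)
    qed
    then show ?thesis by (auto simp: nonunits_def)
  qed
  have "y \<in> V" if "valuation_subring V" "k \<subseteq> V" for V
    using assms(1)[of V] pole[of V] that valuation_subring.nonunits_subset[of V y]
    by (auto simp: place_def)
  then obtain g where g: "coeffs_in k g" "g \<noteq> 0" "poly g y = 0"
    using in_all_valuation_subrings_imp_algebraic[OF k] by metis
  obtain V where V: "place V" "t \<notin> V" by (rule pole_of_t_exists)
  then show ?thesis
    using valuation_subring.root_in_nonunits_eq_0[OF _ k _ pole[OF V] g] by (simp add: place_def)
qed

text \<open>
  The integral closure of \<open>k[t]\<close> in \<open>L\<close>, described by its places so that the ring structure is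
  evident.
\<close>

definition integers :: "'m set" where
  "integers = {z \<in> L. \<forall>V. place V \<longrightarrow> t \<in> V \<longrightarrow> z \<in> V}"

lemma integers_subring: "subring integers fld"
  unfolding subring_fld_iff
proof (intro conjI ballI)
  have V: "subring V fld" if "place V" for V
    using that valuation_subring.subring by (auto simp: place_def)
  show "1 \<in> integers"
    using L_closed(1) subring_one[OF V] by (simp add: integers_def)
  fix x y assume "x \<in> integers" "y \<in> integers"
  then show "x - y \<in> integers" "x * y \<in> integers"
    using L_closed(3,4) subring_diff[OF V] subring_mult[OF V] by (simp_all add: integers_def)
qed

lemmas integers_closed = subring_closed[OF integers_subring]

lemma k_integers: "a \<in> k \<Longrightarrow> a \<in> integers" and t_integers: "t \<in> integers"
  using k_subset t_in by (auto simp: integers_def place_def)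

lemma poly_t_integers: "coeffs_in k p \<Longrightarrow> poly p t \<in> integers"
  using coeffs_in_mono[of k p integers] k_integers t_integers
  by (intro poly_in_subring[OF integers_subring]) auto

text \<open>
  Divide out the largest power of \<open>t\<close> common to all coefficients of the relation.
\<close>

lemma primitive_relation:
  assumes "\<And>i. i \<le> n \<Longrightarrow> coeffs_in k (p i)" "j \<le> n" "p j \<noteq> 0" "(\<Sum>i\<le>n. poly (p i) t * y i) = 0"
  shows "\<exists>q. (\<forall>i\<le>n. coeffs_in k (q i)) \<and> (\<exists>j\<le>n. Polynomial.coeff (q j) 0 \<noteq> 0) \<and>
    (\<Sum>i\<le>n. poly (q i) t * y i) = 0"
  using assms
proof (induction "Polynomial.degree (p j)" arbitrary: p rule: less_induct)
  case less
  show ?case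
  proof (cases "\<exists>j'\<le>n. Polynomial.coeff (p j') 0 \<noteq> 0")
    case True
    then show ?thesis using less.prems(1,4) by blast
  next
    case False
    define q where "q i = (if i \<le> n then poly_shift 1 (p i) else 0)" for i
    have p: "p i = pCons 0 (q i)" if "i \<le> n" for i
      using False that by (intro poly_eqI) (auto simp: coeff_pCons coeff_poly_shift q_def split: nat.splits)
    have "t * (\<Sum>i\<le>n. poly (q i) t * y i) = (\<Sum>i\<le>n. poly (p i) t * y i)"
      by (simp add: p sum_distrib_left mult.assoc)
    then have "(\<Sum>i\<le>n. poly (q i) t * y i) = 0" using less.prems(4) t_nonzero by simp
    moreover have "coeffs_in k (q i)" if "i \<le> n" for i
      using less.prems(1)[OF that] p[OF that] by (simp add: coeffs_in_pCons_iff)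
    moreover have "q j \<noteq> 0" "Polynomial.degree (q j) < Polynomial.degree (p j)"
      using less.prems(2,3) p[of j] by auto
    ultimately show ?thesis using less.hyps[of q] less.prems(2) by blast
  qed
qed

text \<open>
  Linear independence over \<open>k\<close> in the quotient of \<open>integers\<close> by the multiples of \<open>t\<close>.
\<close>

definition independent_mod_t :: "nat \<Rightarrow> (nat \<Rightarrow> 'm) \<Rightarrow> bool" where
  "independent_mod_t d y \<longleftrightarrow> (\<forall>i<d. y i \<in> integers) \<and>
     (\<forall>a. (\<forall>i<d. a i \<in> k) \<longrightarrow> (\<exists>z\<in>integers. (\<Sum>i<d. a i * y i) = t * z) \<longrightarrow> (\<forall>i<d. a i = 0))"

text \<open>
  Elements that are linearly dependent over \<open>k(t)\<close> satisfy a primitive relation over \<open>k[t]\<close>, and its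
  constant coefficients form a nontrivial relation modulo \<open>t\<close>.
\<close>

lemma independent_mod_t_le:
  assumes "independent_mod_t d y"
  shows "d \<le> n"
proof (rule ccontr)
  assume "\<not> d \<le> n"
  then have d: "i < d" if "i \<le> n" for i using that by simp
  have y: "y i \<in> integers" if "i \<le> n" for i using assms d[OF that] by (auto simp: independent_mod_t_def)
  then have "y i \<in> L" if "i \<le> n" for i using that by (auto simp: integers_def)
  then obtain p j where "\<And>i. i \<le> n \<Longrightarrow> coeffs_in k (p i)" "j \<le> n" "p j \<noteq> 0"
      "(\<Sum>i\<le>n. poly (p i) t * y i) = 0"
    using dependent[of y] by blast
  then obtain q j where q: "\<And>i. i \<le> n \<Longrightarrow> coeffs_in k (q i)" "j \<le> n" "Polynomial.coeff (q j) 0 \<noteq> 0"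
      "(\<Sum>i\<le>n. poly (q i) t * y i) = 0"
    using primitive_relation[of p j y] by blast
  define a where "a i = (if i \<le> n then Polynomial.coeff (q i) 0 else 0)" for i
  have ak: "\<forall>i<d. a i \<in> k" using q(1) k_closed(2) by (auto simp: a_def coeffs_in_def)
  define r where "r i = poly_shift 1 (q i)" for i
  have rk: "coeffs_in k (r i)" if "i \<le> n" for i
    using q(1)[OF that] by (auto simp: coeffs_in_def r_def coeff_poly_shift)
  have split: "poly (q i) t = Polynomial.coeff (q i) 0 + t * poly (r i) t" for i
  proof -
    have "q i = pCons (Polynomial.coeff (q i) 0) (r i)"
      by (intro poly_eqI) (auto simp: coeff_pCons coeff_poly_shift r_def split: nat.splits)
    then show ?thesis by (metis poly_pCons)
  qed
  have "(\<Sum>i<d. a i * y i) = (\<Sum>i\<le>n. a i * y i)"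
    by (rule sum.mono_neutral_right) (use d in \<open>auto simp: a_def\<close>)
  also have "\<dots> = (\<Sum>i\<le>n. poly (q i) t * y i) - t * (\<Sum>i\<le>n. poly (r i) t * y i)"
    unfolding sum_distrib_left sum_subtractf[symmetric]
    by (rule sum.cong) (auto simp: a_def split algebra_simps)
  also have "\<dots> = t * (- (\<Sum>i\<le>n. poly (r i) t * y i))" using q by simp
  finally have "(\<Sum>i<d. a i * y i) = t * (- (\<Sum>i\<le>n. poly (r i) t * y i))" .
  moreover have "- (\<Sum>i\<le>n. poly (r i) t * y i) \<in> integers"
    using rk y by (intro integers_closed poly_t_integers) auto
  ultimately have "\<forall>i<d. a i = 0" using assms ak unfolding independent_mod_t_def by blast
  then have "a j = 0" using d[OF q(2)] by blast
  then show False using q(2,3) by (simp add: a_def)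
qed

text \<open>
  The quotient of \<open>integers\<close> by the multiples of \<open>t\<close> is a \<open>k\<close>-vector space of dimension at most \<open>n\<close>,
  and \<open>k\<close> is finite. A largest independent family spans it.
\<close>

lemma finite_residues_mod_t:
  obtains R where "finite R" "\<And>z. z \<in> integers \<Longrightarrow> \<exists>r\<in>R. \<exists>z'\<in>integers. z = r + t * z'"
proof -
  have "\<exists>y. independent_mod_t 0 y" by (simp add: independent_mod_t_def)
  moreover have "\<forall>d. (\<exists>y. independent_mod_t d y) \<longrightarrow> d \<le> n" using independent_mod_t_le by blast
  ultimately have "\<exists>d. (\<exists>y. independent_mod_t d y) \<and> (\<forall>d'. (\<exists>y. independent_mod_t d' y) \<longrightarrow> d' \<le> d)"
    by (rule Nat.ex_has_greatest_nat)
  then obtain d y where y: "independent_mod_t d y" and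
      max: "\<And>d' y'. independent_mod_t d' y' \<Longrightarrow> d' \<le> d"
    by blast
  define R where "R = (\<lambda>a. \<Sum>i<d. a i * y i) ` (Pi\<^sub>E {..<d} (\<lambda>_. k))"
  show ?thesis
  proof
    show "finite R" unfolding R_def using finite_k by (intro finite_imageI finite_PiE) auto
    fix z assume z: "z \<in> integers"
    have "\<not> independent_mod_t (Suc d) (y(d := z))" using max[of "Suc d"] by auto
    moreover have "\<forall>i<Suc d. (y(d := z)) i \<in> integers"
      using y z by (auto simp: independent_mod_t_def less_Suc_eq)
    ultimately obtain a w j where a: "\<forall>i<Suc d. a i \<in> k" "w \<in> integers"
        "(\<Sum>i<Suc d. a i * (y(d := z)) i) = t * w" "j < Suc d" "a j \<noteq> 0"
      unfolding independent_mod_t_def by blast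
    have eq: "(\<Sum>i<d. a i * y i) + a d * z = t * w" using a(3) by simp
    have ad: "a d \<noteq> 0"
    proof
      assume "a d = 0"
      with eq have "(\<Sum>i<d. a i * y i) = t * w" by simp
      moreover have "\<forall>i<d. a i \<in> k" using a by simp
      ultimately have "\<forall>i<d. a i = 0" using y a(2) unfolding independent_mod_t_def by blast
      with a \<open>a d = 0\<close> show False by (auto simp: less_Suc_eq)
    qed
    define c where "c = inverse (a d)"
    have c: "c \<in> k" using a k by (auto simp: c_def subfield_fld_iff)
    have "c * a d * z = c * (t * w) - c * (\<Sum>i<d. a i * y i)"
      unfolding eq[symmetric] by (simp add: algebra_simps)
    then have z_eq: "z = (\<Sum>i<d. (- c * a i) * y i) + t * (c * w)"
      using ad by (simp add: c_def sum_distrib_left sum_negf algebra_simps)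
    define b where "b = restrict (\<lambda>i. - c * a i) {..<d}"
    have "b \<in> Pi\<^sub>E {..<d} (\<lambda>_. k)" using a c k_closed by (auto simp: b_def)
    moreover have "(\<Sum>i<d. (- c * a i) * y i) = (\<Sum>i<d. b i * y i)" by (simp add: b_def)
    ultimately have "(\<Sum>i<d. (- c * a i) * y i) \<in> R" unfolding R_def by blast
    moreover have "c * w \<in> integers" using c a k_integers integers_closed by blast
    ultimately show "\<exists>r\<in>R. \<exists>z'\<in>integers. z = r + t * z'" using z_eq by blast
  qed
qed

lemma finite_residues_mod_t_power:
  "\<exists>R. finite R \<and> (\<forall>z\<in>integers. \<exists>r\<in>R. \<exists>z'\<in>integers. z = r + t ^ s * z')"
proof (induction s)
  case 0
  show ?case by (rule exI[of _ "{0}"]) auto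
next
  case (Suc s)
  then obtain R where R: "finite R" "\<And>z. z \<in> integers \<Longrightarrow> \<exists>r\<in>R. \<exists>z'\<in>integers. z = r + t ^ s * z'"
    by blast
  obtain R' where R': "finite R'" "\<And>z. z \<in> integers \<Longrightarrow> \<exists>r\<in>R'. \<exists>z'\<in>integers. z = r + t * z'"
    using finite_residues_mod_t by blast
  have "\<exists>r\<in>(\<lambda>(r, r'). r + t ^ s * r') ` (R \<times> R'). \<exists>z'\<in>integers. z = r + t ^ Suc s * z'"
    if z: "z \<in> integers" for z
  proof -
    obtain r z1 where r: "r \<in> R" "z1 \<in> integers" "z = r + t ^ s * z1" using R(2)[OF z] by blast
    obtain r' z2 where r': "r' \<in> R'" "z2 \<in> integers" "z1 = r' + t * z2" using R'(2)[OF r(2)] by blast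
    have "z = (r + t ^ s * r') + t ^ Suc s * z2" using r r' by (simp add: algebra_simps)
    then show ?thesis using r r' by force
  qed
  moreover have "finite ((\<lambda>(r, r'). r + t ^ s * r') ` (R \<times> R'))" using R(1) R'(1) by simp
  ultimately show ?case by blast
qed

text \<open>
  A Riemann--Roch space: the poles are bounded by the zeros of \<open>p(t)\<close> away from the poles of \<open>t\<close>, and
  by \<open>t\<^sup>e\<close> at them. After multiplication by \<open>p(t)\<close>, two elements that agree modulo a high power of \<open>t\<close>
  have as difference that power times a function without poles that vanishes at the poles of \<open>t\<close>.
  Hence they are equal, and the space embeds in a finite residue ring.
\<close>

theorem finite_bounded_poles:
  assumes p: "coeffs_in k p" "p \<noteq> 0"
  shows "finite {z \<in> L. (\<forall>V. place V \<longrightarrow> t \<in> V \<longrightarrow> poly p t * z \<in> V) \<and>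
                        (\<forall>V. place V \<longrightarrow> t \<notin> V \<longrightarrow> z / t ^ e \<in> V)}" (is "finite ?Z")
proof -
  define Z where "Z = ?Z"
  \<comment> \<open>\<open>p(t) z\<close> is at most \<open>t\<^sup>s\<close> at the poles of \<open>t\<close>; one more factor \<open>t\<close> forces a zero there.\<close>
  define s where "s = e + Polynomial.degree p"
  obtain R where R: "finite R" "\<forall>z\<in>integers. \<exists>r\<in>R. \<exists>z'\<in>integers. z = r + t ^ Suc s * z'"
    using finite_residues_mod_t_power by blast
  have pt: "poly p t \<noteq> 0" "poly p t \<in> integers" using p transcendental poly_t_integers by blast+
  have "poly p t * z \<in> integers" if "z \<in> Z" for z
    using that pt L_closed(4) by (auto simp: integers_def Z_def)
  then have "\<forall>z\<in>Z. \<exists>r. r \<in> R \<and> (\<exists>z'\<in>integers. poly p t * z = r + t ^ Suc s * z')" using R(2) by blast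
  from bchoice[OF this] obtain r
    where r: "\<And>z. z \<in> Z \<Longrightarrow> r z \<in> R \<and> (\<exists>z'\<in>integers. poly p t * z = r z + t ^ Suc s * z')"
    by blast
  have inj: "inj_on r Z"
  proof (rule inj_onI)
    fix x y assume xy: "x \<in> Z" "y \<in> Z" "r x = r y"
    from r[OF xy(1)] obtain x' where x': "x' \<in> integers" "poly p t * x = r x + t ^ Suc s * x'" by blast
    from r[OF xy(2)] obtain y' where y': "y' \<in> integers" "poly p t * y = r y + t ^ Suc s * y'" by blast
    have eq: "poly p t * (x - y) = t ^ Suc s * (x' - y')" using x' y' xy(3) by (simp add: algebra_simps)
    have "x' - y' = 0"
    proof (rule no_poles_imp_0)
      fix V assume V: "place V" "t \<in> V"
      have "x' - y' \<in> integers" using x' y' integers_closed by blast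
      then show "x' - y' \<in> V" using V by (auto simp: integers_def)
    next
      fix V assume V: "place V" "t \<notin> V"
      interpret valuation_subring V using V by (simp add: place_def)
      have kV: "k \<subseteq> V" using V by (simp add: place_def)
      have "poly p t / t ^ Polynomial.degree p * (x / t ^ e - y / t ^ e) \<in> V"
        using xy V p by (intro closed(4) closed(3) poly_at_pole[OF k kV V(2)]) (auto simp: Z_def)
      also have "poly p t / t ^ Polynomial.degree p * (x / t ^ e - y / t ^ e) = poly p t * (x - y) / t ^ s"
        by (simp add: s_def power_add mult.commute flip: diff_divide_distrib)
      also have "poly p t * (x - y) / t ^ s = t * (x' - y')" unfolding eq using t_nonzero by simp
      finally show "t * (x' - y') \<in> V" .
    qed
    then show "x = y" using eq pt by simp
  qed
  have "r ` Z \<subseteq> R" using r by blast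
  from inj_on_finite[OF inj this R(1)] show ?thesis by (simp add: Z_def)
qed

section \<open>Points with finite orbit\<close>

text \<open>
  Both bounds come from one polynomial relation for \<open>b\<close> over \<open>k[t]\<close>: its leading coefficient is a
  denominator away from the poles of \<open>t\<close>, and the largest degree of a coefficient bounds \<open>b\<close> at them.
\<close>

lemma poles_bounded_in_terms_of_t:
  assumes b: "b \<in> L"
  shows "\<exists>p e. coeffs_in k p \<and> p \<noteq> 0 \<and> (\<forall>V. place V \<longrightarrow> t \<in> V \<longrightarrow> poly p t * b \<in> V)
    \<and> (\<forall>V. place V \<longrightarrow> t \<notin> V \<longrightarrow> b / t ^ e \<in> V)"
proof -
  obtain p where p: "\<And>i. i \<le> n \<Longrightarrow> coeffs_in k (p i)" "\<exists>i\<le>n. p i \<noteq> 0"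
      "(\<Sum>i\<le>n. poly (p i) t * b ^ i) = 0"
    using dependent[of "\<lambda>i. b ^ i"] L_closed(7)[OF b] by blast
  from p(2) obtain j where "j \<le> n \<and> p j \<noteq> 0" by blast
  moreover have "\<forall>i. i \<le> n \<and> p i \<noteq> 0 \<longrightarrow> i \<le> n" by blast
  ultimately have "\<exists>d. (d \<le> n \<and> p d \<noteq> 0) \<and> (\<forall>i. i \<le> n \<and> p i \<noteq> 0 \<longrightarrow> i \<le> d)"
    by (rule Nat.ex_has_greatest_nat)
  then obtain d where d: "d \<le> n" "p d \<noteq> 0" "\<And>i. i \<le> n \<Longrightarrow> p i \<noteq> 0 \<Longrightarrow> i \<le> d"
    by blast
  have root: "(\<Sum>i\<le>d. poly (p i) t * b ^ i) = 0"
    using p(3) sum.mono_neutral_right[of "{..n}" "{..d}" "\<lambda>i. poly (p i) t * b ^ i"] d by force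
  have dpos: "d > 0"
  proof (rule ccontr)
    assume "\<not> d > 0"
    then have "poly (p d) t = 0" using root by simp
    then show False using transcendental p d by blast
  qed
  \<comment> \<open>Any common bound for the degrees will do.\<close>
  define e where "e = (\<Sum>i\<le>d. Polynomial.degree (p i))"
  show ?thesis
  proof (intro exI conjI allI impI)
    show "coeffs_in k (p d)" "p d \<noteq> 0" using p d by auto
    show "poly (p d) t * b \<in> V" if "place V" "t \<in> V" for V
    proof -
      interpret valuation_subring V using that by (simp add: place_def)
      have "poly (p i) t \<in> V" if "i \<le> d" for i
        using poly_t_integers[OF p(1)] that d \<open>place V\<close> \<open>t \<in> V\<close> by (auto simp: integers_def)
      then show ?thesis using leading_coeff_times_root[OF _ dpos root] by simp
    qed
    show "b / t ^ e \<in> V" if "place V" "t \<notin> V" for V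
    proof -
      interpret valuation_subring V using that by (simp add: place_def)
      have kV: "k \<subseteq> V" using that by (simp add: place_def)
      have "Polynomial.degree (p i) \<le> e" if "i \<le> d" for i
        unfolding e_def using that by (intro member_le_sum) auto
      then show ?thesis using p d(1,2) by (intro root_at_pole[OF k kV that(2) _ _ _ dpos root]) auto
    qed
  qed
qed

text \<open>
  A Northcott property. A point \<open>u\<close> of finite orbit is bounded, at each place, by one of
  finitely many elements of \<open>L\<close> that depend on \<open>f\<close> only. So \<open>u\<^sup>N\<close> lies in a Riemann--Roch space
  that depends only on \<open>f\<close> and \<open>N\<close>, and such a space is finite.
\<close>

theorem finite_finite_orbit_radicals:
  assumes f: "coeffs_in L f" "Polynomial.degree f \<ge> 2" and N: "N > 0"
  shows "finite {u. u ^ N \<in> L \<and> finite (range (\<lambda>j. (poly f ^^ j) u))}" (is "finite ?U")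
proof -
  define B where "B = escape_bounds f"
  have B: "finite B" by (simp add: B_def escape_bounds_def)
  have BL: "b \<in> L" if "b \<in> B" for b
  proof -
    have cL: "Polynomial.coeff f i \<in> L" for i using f by (simp add: coeffs_in_def)
    moreover have "inverse (lead_coeff f) \<in> L" using cL L by (simp add: subfield_fld_iff)
    ultimately show ?thesis using that L_closed
      by (auto simp: B_def escape_bounds_def divide_inverse)
  qed
  have "\<forall>b\<in>B. \<exists>p e. coeffs_in k p \<and> p \<noteq> 0 \<and> (\<forall>V. place V \<longrightarrow> t \<in> V \<longrightarrow> poly p t * b \<in> V)
      \<and> (\<forall>V. place V \<longrightarrow> t \<notin> V \<longrightarrow> b / t ^ e \<in> V)"
    using BL poles_bounded_in_terms_of_t by blast
  from bchoice[OF this] obtain p where "\<forall>b\<in>B. \<exists>e. coeffs_in k (p b) \<and> p b \<noteq> 0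
      \<and> (\<forall>V. place V \<longrightarrow> t \<in> V \<longrightarrow> poly (p b) t * b \<in> V)
      \<and> (\<forall>V. place V \<longrightarrow> t \<notin> V \<longrightarrow> b / t ^ e \<in> V)" by blast
  from bchoice[OF this] obtain e where pe: "\<And>b. b \<in> B \<Longrightarrow> coeffs_in k (p b)" "\<And>b. b \<in> B \<Longrightarrow> p b \<noteq> 0"
      "\<And>b V. b \<in> B \<Longrightarrow> place V \<Longrightarrow> t \<in> V \<Longrightarrow> poly (p b) t * b \<in> V"
      "\<And>b V. b \<in> B \<Longrightarrow> place V \<Longrightarrow> t \<notin> V \<Longrightarrow> b / t ^ e b \<in> V"
    by blast
  define P where "P = (\<Prod>b\<in>B. p b)"
  define E where "E = (\<Sum>b\<in>B. e b)"
  have P: "coeffs_in k P" "P \<noteq> 0" using pe B by (auto simp: P_def intro: coeffs_in_prod[OF k_subring])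
  define W where "W = {z \<in> L. (\<forall>V. place V \<longrightarrow> t \<in> V \<longrightarrow> poly (P ^ N) t * z \<in> V) \<and>
                        (\<forall>V. place V \<longrightarrow> t \<notin> V \<longrightarrow> z / t ^ (E * N) \<in> V)}"
  have W: "finite W" unfolding W_def
    using P by (intro finite_bounded_poles coeffs_in_power[OF k_subring]) auto
  have uW: "u ^ N \<in> W" if u: "u \<in> ?U" for u
  proof -
    have bound: "\<exists>b\<in>B. b \<noteq> 0 \<and> u / b \<in> V" if "place V" for V
      using valuation_subring.finite_orbit_bounded[of V f u] that u f(2)
      unfolding B_def place_def by auto
    have "poly (P ^ N) t * u ^ N \<in> V" if V: "place V" "t \<in> V" for V
    proof -
      interpret valuation_subring V using V by (simp add: place_def)
      obtain b where b: "b \<in> B" "b \<noteq> 0" "u / b \<in> V" using bound V by blast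
      have "poly (p b') t \<in> V" if "b' \<in> B" for b'
        using poly_t_integers[OF pe(1)[OF that]] V by (auto simp: integers_def)
      then have "(poly (p b) t * b) * (\<Prod>b'\<in>B - {b}. poly (p b') t) * (u / b) \<in> V"
        using b by (intro closed(4) closed(9) pe(3)[OF b(1) V]) auto
      also have "(poly (p b) t * b) * (\<Prod>b'\<in>B - {b}. poly (p b') t) * (u / b) = poly P t * u"
        using b B by (simp add: P_def poly_prod prod.remove[OF B b(1)])
      finally have "(poly P t * u) ^ N \<in> V" by (rule closed)
      then show ?thesis by (simp add: power_mult_distrib poly_power)
    qed
    moreover have "u ^ N / t ^ (E * N) \<in> V" if V: "place V" "t \<notin> V" for V
    proof -
      interpret valuation_subring V using V by (simp add: place_def)
      have it: "inverse t \<in> V" using V total by blast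
      obtain b where b: "b \<in> B" "b \<noteq> 0" "u / b \<in> V" using bound V by blast
      have "e b \<le> E" unfolding E_def using B b by (intro member_le_sum) auto
      then have tE: "t ^ E = t ^ (E - e b) * t ^ e b" by (simp flip: power_add)
      have "(b / t ^ e b) * inverse t ^ (E - e b) * (u / b) \<in> V"
        using b it by (intro closed(4) closed(7) pe(4)[OF b(1) V]) auto
      also have "(b / t ^ e b) * inverse t ^ (E - e b) * (u / b) = u / t ^ E" using b t_nonzero by (simp add: tE field_simps)
      finally have "(u / t ^ E) ^ N \<in> V" by (rule closed)
      then show ?thesis by (simp add: power_divide power_mult)
    qed
    ultimately show ?thesis using u by (auto simp: W_def)
  qed
  have "?U \<subseteq> (\<Union>w\<in>W. {u. poly (Polynomial.monom 1 N - [:w:]) u = 0})"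
    using uW by (force simp: poly_monom)
  moreover have "finite {u. poly (Polynomial.monom 1 N - [:w:]) u = 0}" for w :: 'm
  proof (rule poly_roots_finite)
    have "Polynomial.degree (Polynomial.monom (1 :: 'm) N) \<noteq> Polynomial.degree [:w:]"
      using N by (simp add: degree_monom_eq)
    then show "Polynomial.monom 1 N - [:w:] \<noteq> 0" by auto
  qed
  ultimately show ?thesis using W by (meson finite_UN finite_subset)
qed

end

section \<open>Finite extensions of a rational function field\<close>

lemma finite_dimension_mono_field:
  fixes K K' :: "'l::field set"
  assumes fin: "ring.finite_dimension fld K UNIV" and sub: "K \<subseteq> K'" and K': "subfield K' fld"
  shows "ring.finite_dimension fld K' UNIV"
proof -
  interpret field "fld :: 'l ring" by (rule field_from_type_algebra)
  have "K \<subseteq> K' \<longrightarrow> (\<exists>Us. E \<subseteq> Span K' Us)" if "dimension n K E" for n K E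
    using that
  proof (induction rule: dimension.induct)
    case (zero_dim K)
    have "{\<zero>\<^bsub>fld\<^esub>} \<subseteq> Span K' []" by simp
    then show ?case by blast
  next
    case (Suc_dim v E n K)
    show ?case
    proof
      assume sub: "K \<subseteq> K'"
      with Suc_dim obtain Us where "E \<subseteq> Span K' Us" by blast
      then have "line_extension K v E \<subseteq> Span K' (v # Us)"
        using sub by (simp add: subset_iff line_extension_mem_iff) blast
      then show "\<exists>Us. line_extension K v E \<subseteq> Span K' Us" by blast
    qed
  qed
  then obtain Us where "UNIV \<subseteq> Span K' Us" using fin sub by (meson finite_dimensionE')
  then have "Span K' Us = UNIV" by blast
  moreover have "finite_dimension K' (Span K' Us)"
    by (rule Span_finite_dimension[OF K']) (simp add: fld_simps)
  ultimately show ?thesis by simp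
qed

text \<open>
  The predicate \<open>ring.transcendental\<close> represents a polynomial by the list of its coefficients,
  leading coefficient first, and the proof translates between the two representations.
\<close>

lemma transcendental_imp_no_root:
  fixes t :: "'l::field"
  assumes t: "ring.transcendental fld k t" and p: "coeffs_in k p" "poly p t = 0"
  shows "p = 0"
proof -
  interpret field "fld :: 'l ring" by (rule field_from_type_algebra)
  have pow: "x [^]\<^bsub>fld\<^esub> n = x ^ n" for x :: 'l and n :: nat
    by (induction n) (simp_all add: fld_simps nat_pow_def)
  have eval: "eval xs x = poly (Poly (rev xs)) x" for xs and x :: 'l
    by (induction xs) (auto simp: pow Poly_append poly_monom fld_simps)
  define xs where "xs = rev (coeffs p)"
  have "set xs \<subseteq> k" using p(1) by (auto simp: xs_def coeffs_in_def coeffs_def)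
  moreover have "xs = [] \<or> hd xs \<noteq> 0"
    by (auto simp: xs_def hd_rev last_coeffs_eq_coeff_degree)
  ultimately have "xs \<in> carrier (univ_poly fld k)"
    unfolding univ_poly_carrier[symmetric] polynomial_def by (auto simp: fld_simps)
  moreover have "[] \<in> carrier (univ_poly (fld :: 'l ring) k)"
    unfolding univ_poly_carrier[symmetric] polynomial_def by simp
  moreover have "eval xs t = eval [] t"
    using p(2) by (simp add: eval xs_def fld_simps)
  ultimately have "xs = []" using t unfolding transcendental_def inj_on_def by blast
  then show ?thesis by (simp add: xs_def)
qed

lemma generate_field_imp_fraction:
  fixes t :: "'l::field"
  assumes k: "subring k fld" and x: "x \<in> generate_field fld (insert t k)"
  shows "\<exists>p q. coeffs_in k p \<and> coeffs_in k q \<and> poly q t \<noteq> 0 \<and> x = poly p t / poly q t"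
  using x
proof (induction x rule: generate_field.induct)
  interpret field "fld :: 'l ring" by (rule field_from_type_algebra)
  have c1: "coeffs_in k 1" by (rule coeffs_in_one[OF k])
  {
    case one
    show ?case using c1 by (intro exI[of _ 1]) (simp add: fld_simps)
  next
    case (incl h)
    show ?case
    proof (cases "h = t")
      case True
      have "coeffs_in k [:0, 1:]"
        using subring_zero[OF k] subring_one[OF k] by (simp add: coeffs_in_pCons_iff coeffs_in_0_iff)
      then show ?thesis using c1 True by (intro exI[of _ "[:0, 1:]"] exI[of _ 1]) simp
    next
      case False
      then have "coeffs_in k [:h:]" using incl by (intro coeffs_in_const[OF k]) auto
      then show ?thesis using c1 by (intro exI[of _ "[:h:]"] exI[of _ 1]) simp
    qed
  next
    case (a_inv h)
    then obtain p q where pq: "coeffs_in k p" "coeffs_in k q" "poly q t \<noteq> 0" "h = poly p t / poly q t" by blast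
    have "\<ominus>\<^bsub>fld\<^esub> h = - h" by (rule minus_equality) (auto simp: fld_simps)
    moreover have "coeffs_in k (- p)" using pq(1) subring_uminus[OF k] by (simp add: coeffs_in_def)
    ultimately show ?case using pq by (intro exI[of _ "- p"] exI[of _ q]) simp
  next
    case (m_inv h)
    then obtain p q where pq: "coeffs_in k p" "coeffs_in k q" "poly q t \<noteq> 0" "h = poly p t / poly q t" by blast
    have h: "h \<noteq> 0" using m_inv by (simp add: fld_simps)
    then have "inv\<^bsub>fld\<^esub> h = inverse h"
      by (intro comm_inv_char) (auto simp: fld_simps)
    then show ?case using pq h by (intro exI[of _ q] exI[of _ p]) simp
  next
    case (eng_add h1 h2)
    then obtain p q r s where pq: "coeffs_in k p" "coeffs_in k q" "poly q t \<noteq> 0" "h1 = poly p t / poly q t"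
      "coeffs_in k r" "coeffs_in k s" "poly s t \<noteq> 0" "h2 = poly r t / poly s t" by metis
    then have "coeffs_in k (p * s + r * q)" "coeffs_in k (q * s)"
      by (auto intro: coeffs_in_add[OF k] coeffs_in_mult[OF k])
    then show ?case using pq
      by (intro exI[of _ "p * s + r * q"] exI[of _ "q * s"])
        (simp add: fld_simps add_frac_eq)
  next
    case (eng_mult h1 h2)
    then obtain p q r s where pq: "coeffs_in k p" "coeffs_in k q" "poly q t \<noteq> 0" "h1 = poly p t / poly q t"
      "coeffs_in k r" "coeffs_in k s" "poly s t \<noteq> 0" "h2 = poly r t / poly s t" by metis
    then have "coeffs_in k (p * r)" "coeffs_in k (q * s)" by (auto intro: coeffs_in_mult[OF k])
    then show ?case using pq
      by (intro exI[of _ "p * r"] exI[of _ "q * s"]) (simp add: fld_simps)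
  }
qed

text \<open>
  More elements than the dimension satisfy a linear relation over \<open>k(t)\<close>; multiply it by the product of
  the denominators of its coefficients.
\<close>

lemma polynomial_dependence:
  fixes t :: "'l::field"
  assumes k: "subfield k fld"
    and fin: "ring.finite_dimension fld (generate_field fld (insert t k)) UNIV"
  shows "\<exists>n::nat. \<forall>y. \<exists>p. (\<forall>i\<le>n. coeffs_in k (p i)) \<and> (\<exists>i\<le>n. p i \<noteq> 0) \<and>
    (\<Sum>i\<le>n. poly (p i) t * y i) = 0"
proof -
  interpret field "fld :: 'l ring" by (rule field_from_type_algebra)
  have kr: "subring k fld" using k by (simp add: subfield_fld_iff)
  define K where "K = generate_field fld (insert t k)"
  have K: "subfield K fld" unfolding K_def
    by (rule generate_field_is_subfield) (simp add: fld_simps)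
  obtain n where n: "dimension n K UNIV" using fin unfolding K_def by blast
  have comb: "combine Ks Us = (\<Sum>i<length Us. Ks ! i * Us ! i)" if "length Ks = length Us" for Ks Us
    using that
    by (induction Ks Us rule: list_induct2)
      (auto simp: fld_simps sum.lessThan_Suc_shift simp del: sum.lessThan_Suc)
  show ?thesis
  proof (intro exI[of _ n] allI)
    fix y :: "nat \<Rightarrow> 'l"
    define Us where "Us = map y [0..<Suc n]"
    have lUs: "length Us = Suc n" by (simp add: Us_def)
    have "dependent K Us"
      using independent_length_le_dimension[OF K n, of Us] lUs by auto
    then obtain Ks where Ks: "length Ks = length Us" "combine Ks Us = \<zero>\<^bsub>fld\<^esub>" "set Ks \<subseteq> K"
        "set Ks \<noteq> {\<zero>\<^bsub>fld\<^esub>}"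
      using dependent_imp_non_trivial_combine[OF K, of Us] by (auto simp: fld_simps)
    have "Ks \<noteq> []" using Ks(1) lUs by auto
    then have "\<exists>x\<in>set Ks. x \<noteq> 0"
      using Ks(4) by (auto simp: fld_simps neq_Nil_conv)
    then obtain j where j: "j \<le> n" "Ks ! j \<noteq> 0"
      using Ks(1) lUs by (metis in_set_conv_nth less_Suc_eq_le)
    have "\<forall>i\<le>n. \<exists>a b. coeffs_in k a \<and> coeffs_in k b \<and> poly b t \<noteq> 0 \<and> Ks ! i = poly a t / poly b t"
    proof (intro allI impI)
      fix i assume "i \<le> n"
      then have "Ks ! i \<in> K" using Ks(1,3) lUs by (metis le_imp_less_Suc nth_mem subsetD)
      then show "\<exists>a b. coeffs_in k a \<and> coeffs_in k b \<and> poly b t \<noteq> 0 \<and> Ks ! i = poly a t / poly b t"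
        unfolding K_def by (rule generate_field_imp_fraction[OF kr])
    qed
    then obtain a b where ab: "\<And>i. i \<le> n \<Longrightarrow> coeffs_in k (a i) \<and> coeffs_in k (b i) \<and>
        poly (b i) t \<noteq> 0 \<and> Ks ! i = poly (a i) t / poly (b i) t"
      by metis
    define Q where "Q = (\<Prod>i\<le>n. poly (b i) t)"
    define p where "p i = a i * (\<Prod>l\<in>{..n} - {i}. b l)" for i
    have Q: "Q \<noteq> 0" using ab by (simp add: Q_def)
    have p: "poly (p i) t = Q * Ks ! i" if "i \<le> n" for i
    proof -
      have "Q = poly (b i) t * (\<Prod>l\<in>{..n} - {i}. poly (b l) t)"
        unfolding Q_def using that by (intro prod.remove) auto
      then show ?thesis using ab[OF that] by (simp add: p_def poly_prod)
    qed
    have "(\<Sum>i\<le>n. poly (p i) t * y i) = Q * (\<Sum>i\<le>n. Ks ! i * y i)"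
      unfolding sum_distrib_left by (rule sum.cong) (auto simp: p)
    also have "(\<Sum>i\<le>n. Ks ! i * y i) = (\<Sum>i<length Us. Ks ! i * Us ! i)"
    proof (rule sum.cong)
      show "{..n} = {..<length Us}" using lUs by auto
      fix i assume "i \<in> {..<length Us}"
      then have "Us ! i = y i" using lUs unfolding Us_def by (simp del: upt_Suc)
      then show "Ks ! i * y i = Ks ! i * Us ! i" by simp
    qed
    also have "\<dots> = 0" using Ks(2) comb[OF Ks(1)] by (simp add: fld_simps)
    finally have "(\<Sum>i\<le>n. poly (p i) t * y i) = 0" by simp
    moreover have "coeffs_in k (p i)" if "i \<le> n" for i
      unfolding p_def using ab that by (intro coeffs_in_mult[OF kr] coeffs_in_prod[OF kr]) auto
    moreover have "p j \<noteq> 0" using p[OF j(1)] j(2) Q by auto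
    ultimately show "\<exists>p. (\<forall>i\<le>n. coeffs_in k (p i)) \<and> (\<exists>i\<le>n. p i \<noteq> 0) \<and> (\<Sum>i\<le>n. poly (p i) t * y i) = 0"
      using j(1) by blast
  qed
qed

lemma poly_map_poly_to_ac: "poly (map_poly to_ac p) (to_ac x) = to_ac (poly p x)"
  by (induction p) (simp_all add: map_poly_pCons)

lemma map_poly_to_ac_add: "map_poly to_ac (p + q) = map_poly to_ac p + map_poly to_ac q"
  by (intro poly_eqI) (simp add: coeff_map_poly)

lemma map_poly_to_ac_mult: "map_poly to_ac (p * q) = map_poly to_ac p * map_poly to_ac q"
  by (intro poly_eqI) (simp add: coeff_map_poly coeff_mult to_ac_sum)

lemma map_poly_to_ac_pcompose:
  "map_poly to_ac (pcompose p q) = pcompose (map_poly to_ac p) (map_poly to_ac q)"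
  by (induction p) (simp_all add: pcompose_pCons map_poly_pCons map_poly_to_ac_add map_poly_to_ac_mult)

lemma to_ac_image_subfield:
  assumes "subfield S fld"
  shows "subfield (to_ac ` S) fld"
  unfolding subfield_fld_iff subring_fld_iff
proof (intro conjI ballI)
  have S: "subring S fld" "\<And>x. x \<in> S \<Longrightarrow> inverse x \<in> S" using assms by (auto simp: subfield_fld_iff)
  show "1 \<in> to_ac ` S" using subring_one[OF S(1)] by (metis imageI to_ac_1)
  fix x assume "x \<in> to_ac ` S"
  then obtain a where a: "x = to_ac a" "a \<in> S" by blast
  show "inverse x \<in> to_ac ` S" using S(2)[OF a(2)] a(1) by (metis imageI to_ac_inverse)
  fix y assume "y \<in> to_ac ` S"
  then obtain b where b: "y = to_ac b" "b \<in> S" by blast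
  show "x - y \<in> to_ac ` S" using subring_diff[OF S(1) a(2) b(2)] a(1) b(1) by (metis imageI to_ac_diff)
  show "x * y \<in> to_ac ` S" using subring_mult[OF S(1) a(2) b(2)] a(1) b(1) by (metis imageI to_ac_mult)
qed

text \<open>
  The parameters of twists live in the algebraic closure, so the function field is moved into it.
\<close>

theorem finite_over_rational_functions_to_ac:
  fixes k :: "'l::field set"
  assumes k: "finite k" "subfield k fld" and t: "ring.transcendental fld k t"
    and fin: "ring.finite_dimension fld (generate_field fld (insert t k)) UNIV"
  obtains n where "finite_over_rational_functions (to_ac ` k) (range to_ac) (to_ac t) n"
proof -
  obtain n :: nat where n: "\<And>y. \<exists>p. (\<forall>i\<le>n. coeffs_in k (p i)) \<and> (\<exists>i\<le>n. p i \<noteq> 0) \<and>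
      (\<Sum>i\<le>n. poly (p i) t * y i) = 0"
    using polynomial_dependence[OF k(2) fin] by metis
  have "finite_over_rational_functions (to_ac ` k) (range to_ac) (to_ac t) n"
  proof (rule finite_over_rational_functions.intro)
    show "finite (to_ac ` k)" "to_ac ` k \<subseteq> range to_ac" "to_ac t \<in> range to_ac" using k by auto
    show "subfield (to_ac ` k) fld" by (rule to_ac_image_subfield[OF k(2)])
    show "subfield (range (to_ac :: 'l \<Rightarrow> _)) fld"
      by (rule to_ac_image_subfield) (simp add: subfield_fld_iff subring_fld_iff)
    fix p assume p: "coeffs_in (to_ac ` k) p" "poly p (to_ac t) = 0"
    define p' where "p' = map_poly of_ac p"
    have of0: "of_ac 0 = (0 :: 'l)" using of_ac_to_ac[of 0] by simp
    have p': "p = map_poly to_ac p'" "coeffs_in k p'"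
    proof -
      have c: "\<exists>a\<in>k. Polynomial.coeff p i = to_ac a" for i using p(1) by (auto simp: coeffs_in_def)
      show "p = map_poly to_ac p'"
      proof (rule poly_eqI)
        fix i
        show "Polynomial.coeff p i = Polynomial.coeff (map_poly to_ac p') i"
          using c[of i] by (auto simp: p'_def coeff_map_poly of0)
      qed
      show "coeffs_in k p'"
        unfolding coeffs_in_def
      proof
        fix i show "Polynomial.coeff p' i \<in> k"
          using c[of i] by (auto simp: p'_def coeff_map_poly of0)
      qed
    qed
    then have "poly p' t = 0" using p(2) by (simp add: poly_map_poly_to_ac)
    then show "p = 0" using transcendental_imp_no_root[OF t p'(2)] p'(1) by simp
  next
    fix y :: "nat \<Rightarrow> 'l alg_closure" assume y: "\<And>i. i \<le> n \<Longrightarrow> y i \<in> range to_ac"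
    obtain p where p: "\<forall>i\<le>n. coeffs_in k (p i)" "\<exists>i\<le>n. p i \<noteq> 0"
        "(\<Sum>i\<le>n. poly (p i) t * of_ac (y i)) = 0"
      using n[of "\<lambda>i. of_ac (y i)"] by blast
    define q where "q i = map_poly to_ac (p i)" for i
    have "(\<Sum>i\<le>n. poly (q i) (to_ac t) * y i) = to_ac (\<Sum>i\<le>n. poly (p i) t * of_ac (y i))"
      unfolding to_ac_sum by (rule sum.cong) (auto simp: q_def poly_map_poly_to_ac to_ac_of_ac[OF y])
    moreover have "\<forall>i\<le>n. coeffs_in (to_ac ` k) (q i)"
      using p(1) by (auto simp: q_def coeffs_in_def coeff_map_poly)
    moreover have "\<exists>i\<le>n. q i \<noteq> 0"
      using p(2) by (auto simp: q_def map_poly_eq_0_iff)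
    ultimately show "\<exists>p. (\<forall>i\<le>n. coeffs_in (to_ac ` k) (p i)) \<and> (\<exists>i\<le>n. p i \<noteq> 0) \<and>
        (\<Sum>i\<le>n. poly (p i) (to_ac t) * y i) = 0"
      using p(3) by (metis to_ac_0)
  qed
  then show ?thesis by (rule that)
qed

section \<open>Twists with torsion\<close>

lemma coeff_pcompose_scale:
  "Polynomial.coeff (pcompose p [:0, u:]) i = u ^ i * Polynomial.coeff p i" for u :: "'a::comm_ring_1"
  using coeff_pcompose_monom_linear[of p u i] by (simp add: monom_Suc monom_0)

lemma isomorphic_over_to_ac_iff:
  "isomorphic_over to_ac A \<phi> \<psi> \<longleftrightarrow> (\<exists>u. u \<noteq> 0 \<and> (\<forall>a\<in>A. \<forall>i.
     u ^ i * to_ac (Polynomial.coeff (\<phi> a) i) = u * to_ac (Polynomial.coeff (\<psi> a) i)))"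
  by (simp add: isomorphic_over_def poly_eq_iff coeff_pcompose_scale coeff_map_poly)

lemma isomorphism_rel_iff:
  "(\<phi>, \<psi>) \<in> isomorphism_rel A \<longleftrightarrow> (\<exists>u. u \<noteq> 0 \<and> (\<forall>a\<in>A. \<forall>i.
     u ^ i * Polynomial.coeff (\<phi> a) i = u * Polynomial.coeff (\<psi> a) i))"
  by (simp add: isomorphism_rel_def isomorphic_over_def poly_eq_iff coeff_pcompose_scale coeff_map_poly)

text \<open>
  A relation \<open>Q\<close> suffices in place of a function on \<open>S\<close>, because a class may have several
  parameters, none of them canonical.
\<close>

lemma finite_quotient_of_parameters:
  assumes r: "equiv UNIV r" and U: "finite U"
    and ex: "\<And>x. x \<in> S \<Longrightarrow> \<exists>u\<in>U. Q x u"
    and same: "\<And>x y u. Q x u \<Longrightarrow> Q y u \<Longrightarrow> (x, y) \<in> r"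
  shows "finite (S // r)"
proof -
  have "S // r \<subseteq> (\<lambda>u. r `` {SOME x. Q x u}) ` U"
  proof
    fix C assume "C \<in> S // r"
    then obtain x where x: "x \<in> S" "C = r `` {x}" by (auto simp: quotient_def)
    then obtain u where u: "u \<in> U" "Q x u" using ex by blast
    have "(x, SOME x. Q x u) \<in> r" using u same someI[of "\<lambda>x. Q x u" x] by blast
    then have "C = r `` {SOME x. Q x u}" using x equiv_class_eq[OF r] by blast
    then show "C \<in> (\<lambda>u. r `` {SOME x. Q x u}) ` U" using u by blast
  qed
  then show ?thesis using U finite_surj by blast
qed

text \<open>
  The constant coefficient vanishes because \<open>0\<close> is not a power of \<open>card k\<close>.
\<close>

lemma drinfeld_moduleD:
  assumes \<phi>: "drinfeld_module k A \<phi>" and k: "finite k" "k \<noteq> {}"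
  shows drinfeld_coeff_0: "a \<in> A \<Longrightarrow> Polynomial.coeff (\<phi> a) 0 = 0"
    and drinfeld_coeff_1: "a \<in> A \<Longrightarrow> a \<noteq> 0 \<Longrightarrow> Polynomial.coeff (\<phi> a) 1 = a"
    and drinfeld_commute: "a \<in> A \<Longrightarrow> b \<in> A \<Longrightarrow> pcompose (\<phi> a) (\<phi> b) = pcompose (\<phi> b) (\<phi> a)"
proof -
  obtain r where r: "drinfeld_module_of_rank k A r \<phi>" using \<phi> by (auto simp: drinfeld_module_def)
  note d = r[unfolded drinfeld_module_of_rank_def]
  show "Polynomial.coeff (\<phi> a) 0 = 0" if "a \<in> A"
  proof (rule ccontr)
    assume "Polynomial.coeff (\<phi> a) 0 \<noteq> 0"
    moreover have "Fq_linear (card k) (\<phi> a)" using d that by blast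
    ultimately obtain j where "0 = card k ^ j" unfolding Fq_linear_def by blast
    then show False using k by simp
  qed
  show "Polynomial.coeff (\<phi> a) 1 = a" if "a \<in> A" "a \<noteq> 0" using d that by blast
  show "pcompose (\<phi> a) (\<phi> b) = pcompose (\<phi> b) (\<phi> a)" if "a \<in> A" "b \<in> A"
    using d that by (metis mult.commute)
qed

text \<open>
  A twist is given by \<open>u\<close> in the algebraic closure with \<open>\<phi>\<^sub>a(u x) = u \<psi>\<^sub>a(x)\<close>. A torsion point \<open>\<alpha> \<noteq> 0\<close> of \<open>\<psi>\<close>
  yields the torsion point \<open>w = u \<alpha>\<close> of \<open>\<phi>\<close>, and \<open>w\<close> determines \<open>\<psi>\<close> up to isomorphism over \<open>L\<close>, since
  rescaling \<open>\<psi>\<close> by \<open>\<alpha>\<close> replaces \<open>u\<close> by \<open>w\<close>. So it suffices to confine \<open>w\<close> to a finite set.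
\<close>

lemma finite_twists_with_torsion:
  fixes k A :: "'l::field set"
  assumes k: "finite k" "subfield k fld" and t: "ring.transcendental fld k t"
    and fin: "ring.finite_dimension fld (generate_field fld (insert t k)) UNIV"
    and A: "1 \<in> A" and \<phi>: "drinfeld_module k A \<phi>"
  shows "finite ({\<psi>. is_twist k A \<phi> \<psi> \<and> torsion A \<psi> \<noteq> {0}} // isomorphism_rel A)" (is "finite (?S // _)")
proof -
  have k0: "k \<noteq> {}" using k(2) subring_one by (auto simp: subfield_fld_iff)
  note D = drinfeld_moduleD[OF _ k(1) k0]
  have twist: "drinfeld_module k A \<psi>" if "\<psi> \<in> ?S" for \<psi> using that by (simp add: is_twist_def)
  have iso: "\<exists>u. u \<noteq> 0 \<and> (\<forall>a\<in>A. \<forall>i.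
      u ^ i * to_ac (Polynomial.coeff (\<phi> a) i) = u * to_ac (Polynomial.coeff (\<psi> a) i))"
    if "\<psi> \<in> ?S" for \<psi>
    using that by (simp add: is_twist_def isomorphic_over_to_ac_iff)
  have tors: "\<exists>\<alpha> a. \<alpha> \<noteq> 0 \<and> a \<in> A \<and> a \<noteq> 0 \<and> poly (\<psi> a) \<alpha> = 0" if "\<psi> \<in> ?S" for \<psi>
  proof -
    have "poly (\<psi> 1) 0 = 0" using D(1)[OF twist[OF that] A] by (simp add: poly_0_coeff_0)
    then have "0 \<in> torsion A \<psi>" unfolding torsion_def using A by (auto intro!: bexI[of _ 1])
    moreover have "torsion A \<psi> \<noteq> {0}" using that by simp
    ultimately obtain \<alpha> where "\<alpha> \<in> torsion A \<psi>" "\<alpha> \<noteq> 0" by blast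
    then show ?thesis by (auto simp: torsion_def)
  qed
  show ?thesis
  proof (cases "\<forall>a\<in>A. Polynomial.degree (\<phi> a) \<le> 1")
    case True
    \<comment> \<open>Every twist is then \<open>a \<mapsto> a x\<close>, which has no nonzero torsion.\<close>
    have "\<psi> \<notin> ?S" for \<psi>
    proof
      assume \<psi>: "\<psi> \<in> ?S"
      obtain u where u: "u \<noteq> 0" "\<And>a i. a \<in> A \<Longrightarrow>
          u ^ i * to_ac (Polynomial.coeff (\<phi> a) i) = u * to_ac (Polynomial.coeff (\<psi> a) i)"
        using iso[OF \<psi>] by blast
      obtain \<alpha> a where \<alpha>: "\<alpha> \<noteq> 0" "a \<in> A" "a \<noteq> 0" "poly (\<psi> a) \<alpha> = 0" using tors[OF \<psi>] by blast
      have "Polynomial.coeff (\<psi> a) i = 0" if "i > 1" for i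
      proof -
        have "Polynomial.coeff (\<phi> a) i = 0" using True \<alpha>(2) that by (intro coeff_eq_0) force
        then show ?thesis using u(2)[OF \<alpha>(2), of i] u(1) by simp
      qed
      then have "\<psi> a = [:0, a:]"
        using D(1,2)[OF twist[OF \<psi>] \<alpha>(2)] \<alpha>(3)
        by (intro poly_eqI) (auto simp: coeff_pCons split: nat.splits)
      then show False using \<alpha> by simp
    qed
    then have "?S = {}" by blast
    then show ?thesis by (simp only: quotient_empty finite.emptyI)
  next
    case False
    then obtain T where T: "T \<in> A" "Polynomial.degree (\<phi> T) \<ge> 2" by force
    define d where "d = Polynomial.degree (\<phi> T)"
    define h where "h = map_poly (to_ac :: 'l \<Rightarrow> _)"
    define f where "f = h (\<phi> T)"
    \<comment> \<open>Torsion points of \<open>\<phi>\<close> have finite orbit under \<open>\<phi>\<^sub>T\<close>, and the leading coefficients of \<open>\<phi>\<^sub>T\<close> and \<open>\<psi>\<^sub>T\<close>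
        show that the power \<open>d - 1\<close> of the parameter of a twist is in \<open>L\<close>.\<close>
    define U where "U = {u. u ^ (d - 1) \<in> range to_ac \<and> finite (range (\<lambda>j. (poly f ^^ j) u))}"
    obtain n where n: "finite_over_rational_functions (to_ac ` k) (range to_ac) (to_ac t) n"
      using finite_over_rational_functions_to_ac[OF k t fin] .
    have "finite U"
      unfolding U_def
    proof (rule finite_over_rational_functions.finite_finite_orbit_radicals[OF n])
      show "coeffs_in (range to_ac) f" by (auto simp: coeffs_in_def f_def h_def coeff_map_poly)
      show "2 \<le> Polynomial.degree f" "0 < d - 1"
        using T by (auto simp: f_def h_def degree_map_poly d_def)
    qed
    define Q where "Q \<psi> w \<longleftrightarrow> (\<exists>u \<alpha>. u \<noteq> 0 \<and> \<alpha> \<noteq> 0 \<and> w = u * to_ac \<alpha> \<and> (\<forall>a\<in>A. \<forall>i.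
        u ^ i * to_ac (Polynomial.coeff (\<phi> a) i) = u * to_ac (Polynomial.coeff (\<psi> a) i)))" for \<psi> w
    show ?thesis
    proof (rule finite_quotient_of_parameters[OF equiv_isomorphism_rel \<open>finite U\<close>, where Q = Q])
      fix \<psi> assume \<psi>: "\<psi> \<in> ?S"
      obtain u where u: "u \<noteq> 0" "\<And>a i. a \<in> A \<Longrightarrow>
          u ^ i * to_ac (Polynomial.coeff (\<phi> a) i) = u * to_ac (Polynomial.coeff (\<psi> a) i)"
        using iso[OF \<psi>] by blast
      obtain \<alpha> a where \<alpha>: "\<alpha> \<noteq> 0" "a \<in> A" "a \<noteq> 0" "poly (\<psi> a) \<alpha> = 0" using tors[OF \<psi>] by blast
      define w where "w = u * to_ac \<alpha>"
      have "Q \<psi> w" unfolding Q_def w_def using u \<alpha> by blast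
      moreover have "w ^ (d - 1) \<in> range to_ac"
      proof -
        define c where "c = Polynomial.coeff (\<phi> T) d"
        have c: "c \<noteq> 0" using T by (auto simp: c_def d_def)
        have "u ^ d = u * u ^ (d - 1)" using T by (simp add: d_def power_eq_if)
        then have "u ^ (d - 1) * to_ac c = to_ac (Polynomial.coeff (\<psi> T) d)"
          using u(2)[OF T(1), of d] u(1) by (simp add: c_def)
        then have "u ^ (d - 1) = to_ac (Polynomial.coeff (\<psi> T) d / c)" using c by (simp add: field_simps)
        then have "w ^ (d - 1) = to_ac (Polynomial.coeff (\<psi> T) d / c * \<alpha> ^ (d - 1))"
          by (simp add: w_def power_mult_distrib)
        then show ?thesis by blast
      qed
      \<comment> \<open>As \<open>\<phi>\<^sub>a\<close> and \<open>\<phi>\<^sub>T\<close> commute, the orbit stays among the roots of \<open>\<phi>\<^sub>a\<close>.\<close>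
      moreover have "finite (range (\<lambda>j. (poly f ^^ j) w))"
      proof (rule finite_subset)
        have eq: "pcompose (h (\<phi> a)) [:0, u:] = Polynomial.smult u (h (\<psi> a))"
          using u(2)[OF \<alpha>(2)] by (simp add: poly_eq_iff coeff_pcompose_scale coeff_map_poly h_def)
        have "poly (h (\<phi> a)) w = poly (pcompose (h (\<phi> a)) [:0, u:]) (to_ac \<alpha>)"
          by (simp add: poly_pcompose w_def mult.commute)
        also have "\<dots> = 0" unfolding eq using \<alpha>(4) by (simp add: h_def poly_map_poly_to_ac)
        finally have root: "poly (h (\<phi> a)) w = 0" .
        have comm: "pcompose (h (\<phi> a)) f = pcompose f (h (\<phi> a))"
          using D(3)[OF \<phi> \<alpha>(2) T(1)] by (simp add: f_def h_def flip: map_poly_to_ac_pcompose)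
        have f0: "poly f 0 = 0"
          using D(1)[OF \<phi> T(1)] by (simp add: f_def h_def poly_0_coeff_0 coeff_map_poly)
        have "poly (h (\<phi> a)) ((poly f ^^ j) w) = 0" for j
        proof (induction j)
          case (Suc j)
          have "poly (h (\<phi> a)) (poly f x) = poly f (poly (h (\<phi> a)) x)" for x
            using comm by (metis poly_pcompose)
          then show ?case using Suc f0 by simp
        qed (use root in simp)
        then show "range (\<lambda>j. (poly f ^^ j) w) \<subseteq> {x. poly (h (\<phi> a)) x = 0}" by blast
        have "Polynomial.coeff (h (\<phi> a)) 1 \<noteq> 0"
          using D(2)[OF \<phi> \<alpha>(2,3)] \<alpha>(3) by (simp add: h_def coeff_map_poly)
        then have "h (\<phi> a) \<noteq> 0" by auto
        then show "finite {x. poly (h (\<phi> a)) x = 0}" by (rule poly_roots_finite)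
      qed
      ultimately show "\<exists>w\<in>U. Q \<psi> w" by (auto simp: U_def)
    next
      fix \<psi> \<psi>' w assume "Q \<psi> w" "Q \<psi>' w"
      then obtain u v \<alpha> \<beta> where *: "u \<noteq> 0" "v \<noteq> 0" "\<alpha> \<noteq> 0" "\<beta> \<noteq> 0" "u * to_ac \<alpha> = v * to_ac \<beta>"
        and 1: "\<And>a i. a \<in> A \<Longrightarrow> u ^ i * to_ac (Polynomial.coeff (\<phi> a) i) = u * to_ac (Polynomial.coeff (\<psi> a) i)"
        and 2: "\<And>a i. a \<in> A \<Longrightarrow> v ^ i * to_ac (Polynomial.coeff (\<phi> a) i) = v * to_ac (Polynomial.coeff (\<psi>' a) i)"
        unfolding Q_def by metis
      define c where "c = \<alpha> / \<beta>"
      have c: "c \<noteq> 0" "v = u * to_ac c" using * by (auto simp: c_def field_simps)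
      have "c ^ i * Polynomial.coeff (\<psi> a) i = c * Polynomial.coeff (\<psi>' a) i" if "a \<in> A" for a i
      proof -
        have "u * to_ac (c ^ i * Polynomial.coeff (\<psi> a) i) =
            to_ac c ^ i * (u ^ i * to_ac (Polynomial.coeff (\<phi> a) i))"
          using 1[OF that, of i] by simp
        also have "\<dots> = v * to_ac (Polynomial.coeff (\<psi>' a) i)"
          using 2[OF that, of i] by (simp add: c(2) power_mult_distrib mult_ac)
        also have "\<dots> = u * to_ac (c * Polynomial.coeff (\<psi>' a) i)" by (simp add: c(2))
        finally have "to_ac (c ^ i * Polynomial.coeff (\<psi> a) i) = to_ac (c * Polynomial.coeff (\<psi>' a) i)"
          using *(1) by (metis mult_left_cancel)
        then show ?thesis unfolding to_ac_eq_iff .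
      qed
      then show "(\<psi>, \<psi>') \<in> isomorphism_rel A" unfolding isomorphism_rel_iff using c(1) by blast
    qed
  qed
qed

theorem theorem4:
  fixes k F P A :: "'l::field set" and \<phi> :: "'l \<Rightarrow> 'l poly"
  assumes "finite k" and "function_field k F"
    and "P \<in> closed_points k F"
    and "A = regular_functions k F P"
    and "ring.finite_dimension fld (fraction_field A) (UNIV :: 'l set)"
    and "drinfeld_module k A \<phi>"
  shows "finite ({\<psi>. is_twist k A \<phi> \<psi> \<and> torsion A \<psi> \<noteq> {0}} // isomorphism_rel A)"
proof -
  interpret field "fld :: 'l ring" by (rule field_from_type_algebra)
  obtain t where k: "subfield k fld" and F: "subfield F fld" and t: "transcendental k t"
    and fin: "finite_dimension (generate_field fld (insert t k)) F"
    using assms(2) by (auto simp: function_field_def)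
  have AF: "A \<subseteq> F" using assms(4) by (auto simp: regular_functions_def)
  have "fraction_field A \<subseteq> F"
    using AF F by (auto simp: fraction_field_def subfield_fld_iff divide_inverse intro!: subring_mult)
  then have "finite_dimension F UNIV" by (rule finite_dimension_mono_field[OF assms(5) _ F])
  moreover have "subfield (generate_field fld (insert t k)) fld"
    by (rule generate_field_is_subfield) (simp add: fld_simps)
  ultimately have "finite_dimension (generate_field fld (insert t k)) UNIV"
    using telescopic_base_dim(1) F fin by blast
  moreover have "1 \<in> A"
    using F by (auto simp: assms(4) regular_functions_def closed_points_def subfield_fld_iff subring_one)
  ultimately show ?thesis
    using finite_twists_with_torsion assms(1,6) k t by blast
qed

end
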